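(* Let $V=\{1,\dots,n\}$, $n\ge 2$, be a set of agents and let $N\ge 1$. Consider initial measures $\{\mu_{i,0}\}_{i\in V}$ such that, for each $i\in V$, $\mu_{i,0}=\frac1N\sum_{j=1}^N\delta_{x^i_j}$ with $x^i_1,\dots,x^i_N\in\mathbb{R}$ and $x^i_1<\dots<x^i_N$. (a) The directed PaWBar algorithm under a strongly connected digraph computes a randomized Wasserstein barycenter of the initial measures: with probability one there is a measure $\mu_\infty$ such that $W_2(\mu_i(t),\mu_\infty)\to 0$ as $t\to\infty$ for every $i\in V$, and $$\mu_\infty\in\arg\min_{\nu\in\mathcal{P}^2(\mathbb{R})}\sum_{i=1}^n\lambda_i W_2(\nu,\mu_{i,0})^2$$ for some random convex vector $\lambda=(\lambda_1,\dots,\lambda_n)^\top$. (b) The symmetric PaWBar algorithm under a connected undirected graph computes a standard Wasserstein barycenter of the initial measures: with probability one there is a measure $\mu_\infty$ such that $W_2(\mu_i(t),\mu_\infty)\to 0$ as $t\to\infty$ for every $i\in V$, and $$\mu_\infty\in\arg\min_{\nu\in\mathcal{P}^2(\mathbb{R})}\sum_{i=1}^n W_2(\nu,\mu_{i,0})^2.$$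
   Context: Notation. $\mathcal{P}^2(\mathbb{R})$ is the set of Borel probability measures on $\mathbb{R}$ with finite second moment, and $W_2$ is the 2-Wasserstein distance. For $\mu,\nu\in\mathcal{P}^2(\mathbb{R})$, $\gamma^{\mathrm{opt}}(\mu,\nu)$ denotes an optimal transport plan between $\mu$ and $\nu$, i.e. a minimizer of $\int|x-y|^2\,d\gamma(x,y)$ over couplings $\gamma$ of $\mu$ and $\nu$. For $a\in[0,1]$, $\pi_a(x,y)=(1-a)x+ay$, and $\#$ denotes push-forward. A convex vector is a vector in $\mathbb{R}^n$ with nonnegative entries summing to one; a random convex vector may depend on the realization of the edge selection process. Directed PaWBar algorithm. $G=(V,E)$ is a weighted directed graph with weight $a_{ij}\in(0,1)$ for each $(i,j)\in E$. Set $\mu_i(0)=\mu_{i,0}$ for $i\in V$. At each time $t=0,1,2,\dots$: select a random edge $(i,j)\in E$, independently over time, according to a time-invariant probability distribution giving every edge positive probability; then set $\mu_i(t+1)=(\pi_{a_{ij}})_\#\gamma^{\mathrm{opt}}(\mu_i(t),\mu_j(t))$, the measures of all other agents being unchanged. Symmetric PaWBar algorithm. $G=(V,E)$ is an undirected graph. Set $\mu_i(0)=\mu_{i,0}$ for $i\in V$. At each time $t$: select a random edge $\{i,j\}\in E$, independently over time, according to a time-invariant probability distribution giving every edge positive probability; then set $\mu_i(t+1)=\mu_j(t+1)=(\pi_{1/2})_\#\gamma^{\mathrm{opt}}(\mu_i(t),\mu_j(t))$, the measures of all other agents being unchanged. "With probability one" is with respect to the law of the random sequence of selected edges. *)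

theory Defs
  imports "HOL-Probability.Probability" "Graph_Theory.Graph_Theory"
begin

definition P2 :: "real measure set" where
  "P2 = {\<mu>. prob_space \<mu> \<and> sets \<mu> = sets borel \<and> integrable \<mu> (\<lambda>x. x\<^sup>2)}"

definition couplings :: "real measure \<Rightarrow> real measure \<Rightarrow> (real \<times> real) measure set" where
  "couplings \<mu> \<nu> =
     {\<gamma>. sets \<gamma> = sets (borel \<Otimes>\<^sub>M borel) \<and> distr \<gamma> borel fst = \<mu> \<and> distr \<gamma> borel snd = \<nu>}"

definition transport_cost :: "(real \<times> real) measure \<Rightarrow> ennreal" where
  "transport_cost \<gamma> = (\<integral>\<^sup>+ (x, y). ennreal (\<bar>x - y\<bar>\<^sup>2) \<partial>\<gamma>)"

(* Meaningful only for arguments in P2, where the infimum is finite: elsewhere enn2real may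
   send an infinite infimum to 0. *)
definition W2 :: "real measure \<Rightarrow> real measure \<Rightarrow> real" where
  "W2 \<mu> \<nu> = sqrt (enn2real (\<Sqinter>\<gamma>\<in>couplings \<mu> \<nu>. transport_cost \<gamma>))"

definition optimal_plan :: "real measure \<Rightarrow> real measure \<Rightarrow> (real \<times> real) measure \<Rightarrow> bool" where
  "optimal_plan \<mu> \<nu> \<gamma> \<longleftrightarrow> is_arg_min transport_cost (\<lambda>\<gamma>. \<gamma> \<in> couplings \<mu> \<nu>) \<gamma>"

(* For arguments in P2 the optimal plan on the real line exists and is unique, so that the
   choice operator picks the optimal plan. *)
definition gamma_opt :: "real measure \<Rightarrow> real measure \<Rightarrow> (real \<times> real) measure" where
  "gamma_opt \<mu> \<nu> = (SOME \<gamma>. optimal_plan \<mu> \<nu> \<gamma>)"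

definition interp :: "real \<Rightarrow> real \<times> real \<Rightarrow> real" where
  "interp a = (\<lambda>(x, y). (1 - a) * x + a * y)"

definition displacement :: "real \<Rightarrow> real measure \<Rightarrow> real measure \<Rightarrow> real measure" where
  "displacement a \<mu> \<nu> = distr (gamma_opt \<mu> \<nu>) borel (interp a)"

definition empirical :: "nat \<Rightarrow> (nat \<Rightarrow> real) \<Rightarrow> real measure" where
  "empirical N x =
     measure_of UNIV (sets borel)
       (\<lambda>A. ennreal (1 / real N) * (\<Sum>j=1..N. emeasure (return borel (x j)) A))"

lemma sets_empirical [simp]: "sets (empirical N x) = sets borel"
  unfolding empirical_def
  by (metis sets.sets_measure_of_eq sets_measure_of_conv space_borel)

lemma emeasure_empirical:
  assumes "A \<in> sets borel"
  shows "emeasure (empirical N x) A =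
           ennreal (1 / real N) * (\<Sum>j=1..N. emeasure (return borel (x j)) A)"
proof (rule emeasure_measure_of[OF empirical_def])
  show "countably_additive (sets (empirical N x))
     (\<lambda>A. ennreal (1 / real N) * (\<Sum>j=1..N. emeasure (return borel (x j)) A))"
  proof (rule countably_additiveI)
    fix A :: "nat \<Rightarrow> real set"
    assume A: "range A \<subseteq> sets (empirical N x)" "disjoint_family A"
    have "(\<Sum>i. ennreal (1 / real N) * (\<Sum>j=1..N. emeasure (return borel (x j)) (A i)))
        = ennreal (1 / real N) * (\<Sum>j=1..N. \<Sum>i. emeasure (return borel (x j)) (A i))"
      by (simp add: ennreal_suminf_cmult suminf_sum)
    also have "(\<Sum>j=1..N. \<Sum>i. emeasure (return borel (x j)) (A i))
        = (\<Sum>j=1..N. emeasure (return borel (x j)) (\<Union>i. A i))"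
      using A by (intro sum.cong refl suminf_emeasure) auto
    finally show "(\<Sum>i. ennreal (1 / real N) * (\<Sum>j=1..N. emeasure (return borel (x j)) (A i)))
        = ennreal (1 / real N) * (\<Sum>j=1..N. emeasure (return borel (x j)) (\<Union>i. A i))" .
  qed
qed (use assms in \<open>auto simp: positive_def\<close>)

primrec directed_pawbar ::
    "(nat \<times> nat \<Rightarrow> real) \<Rightarrow> (nat \<Rightarrow> real measure) \<Rightarrow> (nat \<Rightarrow> nat \<times> nat)
       \<Rightarrow> nat \<Rightarrow> nat \<Rightarrow> real measure" where
  "directed_pawbar a \<mu>0 e 0 = \<mu>0"
| "directed_pawbar a \<mu>0 e (Suc t) =
     (let \<mu> = directed_pawbar a \<mu>0 e t; (i, j) = e t
      in \<mu>(i := displacement (a (i, j)) (\<mu> i) (\<mu> j)))"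

(* An undirected edge {i, j} is read with i < j. The order is immaterial: swapping the
   coordinates maps optimal plans to optimal plans, and interp (1/2) is symmetric. *)
primrec symmetric_pawbar ::
    "(nat \<Rightarrow> real measure) \<Rightarrow> (nat \<Rightarrow> nat set) \<Rightarrow> nat \<Rightarrow> nat \<Rightarrow> real measure" where
  "symmetric_pawbar \<mu>0 e 0 = \<mu>0"
| "symmetric_pawbar \<mu>0 e (Suc t) =
     (let \<mu> = symmetric_pawbar \<mu>0 e t; i = Min (e t); j = Max (e t);
          \<nu> = displacement (1 / 2) (\<mu> i) (\<mu> j)
      in \<mu>(i := \<nu>, j := \<nu>))"

(* Undirected graphs are symmetric loopfree digraphs (pair_graph); an undirected edge stands
   for the two opposite arcs. *)
definition undirected_edges :: "'a pair_pre_digraph \<Rightarrow> 'a set set" where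
  "undirected_edges G = {{i, j} | i j. (i, j) \<in> parcs G}"

(* Law of a sequence of independent edges, each distributed according to p. *)
definition edge_process :: "'e pmf \<Rightarrow> (nat \<Rightarrow> 'e) measure" where
  "edge_process p = PiM UNIV (\<lambda>_. measure_pmf p)"

definition convex_vector :: "nat \<Rightarrow> (nat \<Rightarrow> real) \<Rightarrow> bool" where
  "convex_vector n l \<longleftrightarrow> (\<forall>i\<in>{1..n}. 0 \<le> l i) \<and> (\<Sum>i=1..n. l i) = 1"

definition random_convex_vector :: "'w measure \<Rightarrow> nat \<Rightarrow> ('w \<Rightarrow> nat \<Rightarrow> real) \<Rightarrow> bool" where
  "random_convex_vector M n l \<longleftrightarrow>
     (\<forall>i\<in>{1..n}. (\<lambda>\<omega>. l \<omega> i) \<in> borel_measurable M) \<and> (\<forall>\<omega>\<in>space M. convex_vector n (l \<omega>))"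

definition wasserstein_barycenter ::
    "nat \<Rightarrow> (nat \<Rightarrow> real) \<Rightarrow> (nat \<Rightarrow> real measure) \<Rightarrow> real measure \<Rightarrow> bool" where
  "wasserstein_barycenter n l \<mu> \<nu> \<longleftrightarrow>
     is_arg_min (\<lambda>\<nu>. \<Sum>i=1..n. l i * (W2 \<nu> (\<mu> i))\<^sup>2) (\<lambda>\<nu>. \<nu> \<in> P2) \<nu>"

end

theory Submission
  imports Defs
begin

text \<open>Between empirical measures with sorted atoms the increasing matching is the only optimal plan,
  so every update of the algorithm is an affine averaging of the sorted vectors of atoms, and the
  agents run a linear gossip scheme coordinatewise. Some finite word of edges lets one root agent
  influence all others and hence contracts the diameter of the opinions by a fixed factor; almost
  surely it recurs infinitely often, so the random products of stochastic matrices converge to a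
  rank-one matrix whose common row is the random convex vector. In the symmetric scheme sums are
  conserved, which forces the uniform weights. That the weighted average of sorted atom vectors is a
  barycenter follows from Kantorovich duality, with potentials whose weighted sum is at most
  \<open>t\<^sup>2 / 2\<close> and equals it at the atoms of the average.\<close>

section \<open>Gossip averaging\<close>

text \<open>The two algorithms move different numbers of agents per step, so a step is encoded
  agentwise: under the edge \<open>e\<close>, agent \<open>v\<close> mixes in the share
  \<open>b e v\<close> of the value of \<open>h e v\<close>, and bystanders get share 0. Requiring
  \<open>b e v < 1\<close> does double work: it keeps the atoms strictly sorted, on which the
  identification of the chosen optimal plan rests, and it keeps influence once gained from dying
  out.

  All atom indices see the same edges and hence the same random matrix. Its columns are the runs
  started at indicators, so the limit weights do not depend on the atom index, and one convex vector
  serves the whole measure.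

  For the barycenter, the potentials of all agents must fit together. Each is a maximum of affine
  functions whose slopes are the atoms of one initial measure, but the breakpoints are put, for all
  agents alike, at the midpoints between adjacent atoms of the weighted average. Then one index is
  maximal in all of them at once, and the weighted sum collapses to a tangent line of
  \<open>t^2 / 2\<close>.\<close>

definition gossip_step ::
    "('e \<Rightarrow> 'v \<Rightarrow> real) \<Rightarrow> ('e \<Rightarrow> 'v \<Rightarrow> 'v) \<Rightarrow> 'e \<Rightarrow> ('v \<Rightarrow> real) \<Rightarrow> 'v \<Rightarrow> real" where
  "gossip_step b h e y v = (1 - b e v) * y v + b e v * y (h e v)"

primrec gossip ::
    "('e \<Rightarrow> 'v \<Rightarrow> real) \<Rightarrow> ('e \<Rightarrow> 'v \<Rightarrow> 'v) \<Rightarrow> ('v \<Rightarrow> real) \<Rightarrow> (nat \<Rightarrow> 'e) \<Rightarrow> nat \<Rightarrow> 'v \<Rightarrow> real" where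
  "gossip b h y0 e 0 = y0"
| "gossip b h y0 e (Suc t) = gossip_step b h (e t) (gossip b h y0 e t)"

lemma gossip_step_affine:
  "gossip_step b h e (\<lambda>v. c + s * y v) = (\<lambda>v. c + s * gossip_step b h e y v)"
  by (rule ext) (simp add: gossip_step_def algebra_simps)

text \<open>Equivariance under shifts and, with \<open>s = -1\<close>, reflections: a bound for
  nonnegative states can thus be applied to the distance from the minimum and to the distance from
  the maximum.\<close>

lemma fold_gossip_step_affine:
  "fold (gossip_step b h) w (\<lambda>v. c + s * y v) = (\<lambda>v. c + s * fold (gossip_step b h) w y v)"
  by (induction w arbitrary: y) (simp_all add: gossip_step_affine)

lemma gossip_const: "gossip b h (\<lambda>v. c) e t v = c"
  by (induction t arbitrary: v) (simp_all add: gossip_step_def algebra_simps)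

lemma gossip_add_length:
  assumes "\<And>i. i < length w \<Longrightarrow> e (s + i) = w ! i"
  shows "gossip b h y0 e (s + length w) = fold (gossip_step b h) w (gossip b h y0 e s)"
  using assms
proof (induction w rule: rev_induct)
  case (snoc a w)
  have "\<And>i. i < length w \<Longrightarrow> e (s + i) = w ! i"
    using snoc.prems by (metis length_append_singleton less_SucI nth_append)
  then show ?case
    using snoc.IH snoc.prems[of "length w"] by simp
qed simp

text \<open>Splitting over the countably many values of \<open>e t\<close> reduces a random step to
  a fixed one. This serves the random weights of the directed scheme, whose edges are pairs of
  naturals.\<close>

lemma measurable_gossip:
  fixes p :: "'e::countable pmf"
  shows "(\<lambda>e. gossip b h y0 e t v) \<in> borel_measurable (edge_process p)"
proof (induction t arbitrary: v)
  case (Suc t)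
  have e: "(\<lambda>e. e t) \<in> measurable (edge_process p) (count_space UNIV)"
    unfolding edge_process_def
    using measurable_component_singleton[of t UNIV "\<lambda>_. measure_pmf p"]
    by (simp add: measurable_cong_sets)
  have "(\<lambda>e. gossip_step b h a (gossip b h y0 e t) v) \<in> borel_measurable (edge_process p)" for a
    unfolding gossip_step_def by (intro borel_measurable_add borel_measurable_times Suc.IH) simp_all
  from measurable_compose_countable[OF this e] show ?case
    by simp
qed simp

text \<open>The runs started at indicators are the entries of the product of the step matrices, so
  their limits determine the limit of every other run.\<close>

lemma gossip_linear_comb:
  assumes "finite V" and "\<And>t u. u \<in> V \<Longrightarrow> h (e t) u \<in> V" and "v \<in> V"
  shows "gossip b h y0 e t v = (\<Sum>m\<in>V. y0 m * gossip b h (indicator {m}) e t v)"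
  using \<open>v \<in> V\<close>
proof (induction t arbitrary: v)
  case 0
  have "(\<Sum>m\<in>V. y0 m * indicator {m} v) = (\<Sum>m\<in>V. if m = v then y0 m else 0)"
    by (rule sum.cong) (auto simp: indicator_def)
  with 0 \<open>finite V\<close> show ?case
    by simp
next
  case (Suc t)
  show ?case
    using Suc.IH[OF Suc.prems] Suc.IH[OF assms(2)[OF Suc.prems, of t]]
    by (simp add: gossip_step_def sum_distrib_left sum.distrib sum_subtractf algebra_simps)
qed

text \<open>\<open>expanding\<close> is the form in which connectivity enters: every proper nonempty
  set of agents is heard by someone outside it, so a set of influenced agents can always be
  enlarged.\<close>

locale gossip_network =
  fixes V :: "'v set" and E :: "'e set" and b :: "'e \<Rightarrow> 'v \<Rightarrow> real" and h :: "'e \<Rightarrow> 'v \<Rightarrow> 'v"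
  assumes finite_V: "finite V" and V_nonempty: "V \<noteq> {}"
    and weight_nonneg: "\<lbrakk>e \<in> E; v \<in> V\<rbrakk> \<Longrightarrow> 0 \<le> b e v"
    and weight_less_1: "\<lbrakk>e \<in> E; v \<in> V\<rbrakk> \<Longrightarrow> b e v < 1"
    and partner_in_V: "\<lbrakk>e \<in> E; v \<in> V\<rbrakk> \<Longrightarrow> h e v \<in> V"
    and expanding: "\<lbrakk>S \<subseteq> V; S \<noteq> {}; S \<noteq> V\<rbrakk> \<Longrightarrow> \<exists>e\<in>E. \<exists>v\<in>V - S. 0 < b e v \<and> h e v \<in> S"
begin

lemma gossip_step_ge:
  assumes "e \<in> E" "v \<in> V" "\<And>u. u \<in> V \<Longrightarrow> m \<le> y u"
  shows "m \<le> gossip_step b h e y v"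
proof -
  have "(1 - b e v) * m + b e v * m \<le> gossip_step b h e y v"
    unfolding gossip_step_def using assms weight_nonneg[of e v] weight_less_1[of e v] partner_in_V[of e v]
    by (intro add_mono mult_left_mono) auto
  then show ?thesis by (simp add: algebra_simps)
qed

lemma gossip_step_le:
  assumes "e \<in> E" "v \<in> V" "\<And>u. u \<in> V \<Longrightarrow> y u \<le> m"
  shows "gossip_step b h e y v \<le> m"
proof -
  have "gossip_step b h e y v \<le> (1 - b e v) * m + b e v * m"
    unfolding gossip_step_def using assms weight_nonneg[of e v] weight_less_1[of e v] partner_in_V[of e v]
    by (intro add_mono mult_left_mono) auto
  then show ?thesis by (simp add: algebra_simps)
qed

lemma fold_gossip_step_ge:
  assumes "set w \<subseteq> E" "v \<in> V" "\<And>u. u \<in> V \<Longrightarrow> m \<le> y u"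
  shows "m \<le> fold (gossip_step b h) w y v"
  using assms by (induction w arbitrary: y) (auto intro: gossip_step_ge)

lemma gossip_nonneg:
  assumes "\<And>t. e t \<in> E" "\<And>u. u \<in> V \<Longrightarrow> 0 \<le> y0 u" "v \<in> V"
  shows "0 \<le> gossip b h y0 e t v"
  using assms(2,3) by (induction t arbitrary: v) (auto intro: gossip_step_ge assms(1))

text \<open>After the word \<open>w\<close>, every agent in \<open>S\<close> holds at least the
  share \<open>\<delta>\<close> of the initial value of \<open>r\<close>. One more edge from
  \<open>expanding\<close> adds a listener to \<open>S\<close> at the price of a smaller
  share.\<close>

lemma spreading_word_card:
  assumes r: "r \<in> V" and "Suc k \<le> card V"
  shows "\<exists>S w \<delta>. r \<in> S \<and> S \<subseteq> V \<and> card S = Suc k \<and> set w \<subseteq> E \<and> 0 < \<delta> \<and>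
    (\<forall>y. (\<forall>u\<in>V. 0 \<le> y u) \<longrightarrow> (\<forall>v\<in>S. \<delta> * y r \<le> fold (gossip_step b h) w y v))"
  using assms(2)
proof (induction k)
  case 0
  show ?case
    by (rule exI[of _ "{r}"], rule exI[of _ "[]"], rule exI[of _ 1]) (use r in auto)
next
  case (Suc k)
  then obtain S w \<delta> where S: "r \<in> S" "S \<subseteq> V" "card S = Suc k" and w: "set w \<subseteq> E" and \<delta>: "0 < \<delta>"
    and *: "\<And>y v. (\<And>u. u \<in> V \<Longrightarrow> 0 \<le> y u) \<Longrightarrow> v \<in> S \<Longrightarrow> \<delta> * y r \<le> fold (gossip_step b h) w y v"
    by (metis Suc_leD)
  have "S \<noteq> V" "S \<noteq> {}"
    using S Suc.prems by auto
  from expanding[OF \<open>S \<subseteq> V\<close> this(2,1)] obtain e i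
    where e: "e \<in> E" "i \<in> V - S" "0 < b e i" "h e i \<in> S"
    by blast
  have fS: "finite S"
    using S finite_V finite_subset by blast
  \<comment> \<open>The new agent \<open>i\<close> receives the share \<open>b e i\<close> from a
    member of \<open>S\<close>, and a member \<open>u\<close> retains \<open>1 - b e u\<close> of
    its own value; the minimum serves both.\<close>
  define \<alpha> where "\<alpha> = Min (insert (b e i) ((\<lambda>u. 1 - b e u) ` S))"
  have \<alpha>: "0 < \<alpha>" "\<alpha> \<le> b e i" "\<And>u. u \<in> S \<Longrightarrow> \<alpha> \<le> 1 - b e u"
    unfolding \<alpha>_def using fS e S weight_less_1[OF e(1)] by (auto simp: Min_gr_iff)
  have "\<alpha> * \<delta> * y r \<le> fold (gossip_step b h) (w @ [e]) y v"
    if y: "\<And>u. u \<in> V \<Longrightarrow> 0 \<le> y u" and v: "v \<in> insert i S" for y v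
  proof -
    let ?z = "fold (gossip_step b h) w y"
    have z0: "0 \<le> ?z u" if "u \<in> V" for u
      using fold_gossip_step_ge[OF w that, of 0 y] y by blast
    have vV: "v \<in> V"
      using v e S by auto
    have c0: "0 \<le> \<delta> * y r"
      using \<delta> y r by auto
    show ?thesis
    proof (cases "v = i")
      case True
      have "\<alpha> * (\<delta> * y r) \<le> b e i * ?z (h e i)"
        using \<alpha> *[OF y e(4)] c0 e by (intro mult_mono) auto
      moreover have "0 \<le> (1 - b e i) * ?z i"
        using z0[of i] e weight_less_1[of e i] by auto
      ultimately show ?thesis
        using True by (simp add: gossip_step_def algebra_simps)
    next
      case False
      then have "v \<in> S" using v by auto
      have "\<alpha> * (\<delta> * y r) \<le> (1 - b e v) * ?z v"
        using \<alpha>(1) \<alpha>(3)[OF \<open>v \<in> S\<close>] *[OF y \<open>v \<in> S\<close>] c0 by (intro mult_mono) auto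
      moreover have "0 \<le> b e v * ?z (h e v)"
        using z0[OF partner_in_V[OF e(1) vV]] weight_nonneg[OF e(1) vV] by auto
      ultimately show ?thesis
        by (simp add: gossip_step_def algebra_simps)
    qed
  qed
  moreover have "card (insert i S) = Suc (Suc k)"
    using e fS S by simp
  ultimately show ?case
    using S w e \<alpha> \<delta>
    by (intro exI[of _ "insert i S"] exI[of _ "w @ [e]"] exI[of _ "\<alpha> * \<delta>"]) auto
qed

lemma ex_spreading_word:
  assumes "r \<in> V"
  obtains w \<delta> where "set w \<subseteq> E" "0 < \<delta>"
    "\<And>y v. \<lbrakk>\<And>u. u \<in> V \<Longrightarrow> 0 \<le> y u; v \<in> V\<rbrakk> \<Longrightarrow> \<delta> * y r \<le> fold (gossip_step b h) w y v"
proof -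
  have "card V = Suc (card V - 1)"
    using finite_V V_nonempty by (simp add: card_gt_0_iff)
  then obtain S w \<delta> where *: "S \<subseteq> V" "card S = card V" "set w \<subseteq> E" "0 < \<delta>"
    "\<forall>y. (\<forall>u\<in>V. 0 \<le> y u) \<longrightarrow> (\<forall>v\<in>S. \<delta> * y r \<le> fold (gossip_step b h) w y v)"
    using spreading_word_card[OF assms, of "card V - 1"] by (metis order_refl)
  have "S = V"
    using * finite_V card_subset_eq by blast
  with * that show ?thesis
    by metis
qed

section \<open>Contraction of the diameter and consensus\<close>

definition lo :: "('v \<Rightarrow> real) \<Rightarrow> real" where "lo y = Min (y ` V)"
definition hi :: "('v \<Rightarrow> real) \<Rightarrow> real" where "hi y = Max (y ` V)"

lemma lo_le: "v \<in> V \<Longrightarrow> lo y \<le> y v"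
  by (simp add: lo_def finite_V)

lemma le_hi: "v \<in> V \<Longrightarrow> y v \<le> hi y"
  by (simp add: hi_def finite_V)

lemma lo_ge: "(\<And>v. v \<in> V \<Longrightarrow> m \<le> y v) \<Longrightarrow> m \<le> lo y"
  by (simp add: lo_def finite_V V_nonempty)

lemma hi_le: "(\<And>v. v \<in> V \<Longrightarrow> y v \<le> m) \<Longrightarrow> hi y \<le> m"
  by (simp add: hi_def finite_V V_nonempty)

lemma ex_contracting_word:
  obtains w \<delta> where "set w \<subseteq> E" "0 < \<delta>"
    "\<And>y. hi (fold (gossip_step b h) w y) - lo (fold (gossip_step b h) w y) \<le> (1 - \<delta>) * (hi y - lo y)"
proof -
  obtain r where r: "r \<in> V"
    using V_nonempty by auto
  obtain w \<delta> where w: "set w \<subseteq> E" "0 < \<delta>"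
    and *: "\<And>y v. \<lbrakk>\<And>u. u \<in> V \<Longrightarrow> 0 \<le> y u; v \<in> V\<rbrakk> \<Longrightarrow> \<delta> * y r \<le> fold (gossip_step b h) w y v"
    using ex_spreading_word[OF r] by metis
  have "hi (fold (gossip_step b h) w y) - lo (fold (gossip_step b h) w y) \<le> (1 - \<delta>) * (hi y - lo y)" for y
  proof -
    \<comment> \<open>Shifting by the minimum and reflecting at the maximum make the state
      nonnegative. The two gains add up to \<open>\<delta> * (hi y - lo y)\<close>, whatever the
      value at \<open>r\<close>.\<close>
    have 1: "\<delta> * (y r - lo y) \<le> fold (gossip_step b h) w y v - lo y" if "v \<in> V" for v
      using *[of "\<lambda>v. - lo y + 1 * y v" v] that lo_le[of _ y]
      by (simp only: fold_gossip_step_affine) (simp add: algebra_simps)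
    have 2: "\<delta> * (hi y - y r) \<le> hi y - fold (gossip_step b h) w y v" if "v \<in> V" for v
      using *[of "\<lambda>v. hi y + (-1) * y v" v] that le_hi[of _ y]
      by (simp only: fold_gossip_step_affine) (simp add: algebra_simps)
    have "lo y + \<delta> * (y r - lo y) \<le> lo (fold (gossip_step b h) w y)"
      by (rule lo_ge) (use 1 in force)
    moreover have "hi (fold (gossip_step b h) w y) \<le> hi y - \<delta> * (hi y - y r)"
      by (rule hi_le) (use 2 in force)
    ultimately show ?thesis
      by (simp add: algebra_simps)
  qed
  with w that show ?thesis
    by blast
qed

lemma consensus_if_word_recurs:
  assumes e: "\<And>t. e t \<in> E" and \<delta>: "0 < \<delta>"
    and contr: "\<And>y. hi (fold (gossip_step b h) w y) - lo (fold (gossip_step b h) w y) \<le> (1 - \<delta>) * (hi y - lo y)"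
    and rec: "infinite {k. \<forall>i<length w. e (k * Suc (length w) + i) = w ! i}"
  shows "\<exists>c. \<forall>v\<in>V. (\<lambda>t. gossip b h y0 e t v) \<longlonglongrightarrow> c"
proof -
  let ?y = "gossip b h y0 e"
  let ?L = "Suc (length w)"
  define d where "d t = hi (?y t) - lo (?y t)" for t
  have inc: "incseq (\<lambda>t. lo (?y t))"
    by (intro incseq_SucI lo_ge) (auto intro!: gossip_step_ge e lo_le)
  have dec: "decseq (\<lambda>t. hi (?y t))"
    by (intro decseq_SucI hi_le) (auto intro!: gossip_step_le e le_hi)
  have lohi: "lo y \<le> hi y" for y
    using V_nonempty lo_le[of _ y] le_hi[of _ y] by (meson all_not_in_conv order_trans)
  have d0: "0 \<le> d t" for t
    using lohi by (simp add: d_def)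
  have d_dec: "decseq d"
    using inc dec unfolding d_def monotone_def by (smt (verit))
  obtain D where D: "d \<longlonglongrightarrow> D" "\<And>t. D \<le> d t"
    using decseq_convergent[OF d_dec, of 0] d0 by blast
  have "D \<le> 0"
  proof (rule ccontr)
    assume "\<not> D \<le> 0"
    \<comment> \<open>With this margin, one contraction gives
      \<open>D \<le> (1 - \<delta>) * (1 + \<delta>) * D\<close>, which is impossible for positive
      \<open>D\<close>.\<close>
    then have "D < D + \<delta> * D"
      using \<delta> by simp
    then have "eventually (\<lambda>t. d t < D + \<delta> * D) sequentially"
      using order_tendstoD(2)[OF D(1)] by blast
    then obtain t0 where t0: "\<And>t. t \<ge> t0 \<Longrightarrow> d t < D + \<delta> * D"
      unfolding eventually_sequentially by blast
    obtain k where k: "t0 \<le> k" "\<And>i. i < length w \<Longrightarrow> e (k * ?L + i) = w ! i"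
      using rec unfolding infinite_nat_iff_unbounded_le by blast
    have "D \<le> d (k * ?L + length w)"
      by (rule D)
    also have "\<dots> \<le> (1 - \<delta>) * d (k * ?L)"
      unfolding d_def using contr[of "?y (k * ?L)"] gossip_add_length[OF k(2), of b h y0] by simp
    finally have *: "D \<le> (1 - \<delta>) * d (k * ?L)" .
    then have "\<delta> < 1"
      using d0[of "k * ?L"] \<open>\<not> D \<le> 0\<close> by (smt (verit) mult_nonneg_nonneg mult_minus_left)
    have "t0 \<le> k * ?L"
      using k by (metis mult_le_mono2 le_trans mult.right_neutral Suc_le_mono le0 One_nat_def)
    then have "(1 - \<delta>) * d (k * ?L) \<le> (1 - \<delta>) * (D + \<delta> * D)"
      using t0 \<open>\<delta> < 1\<close> by (intro mult_left_mono) (auto simp: less_imp_le)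
    with * have "D * (\<delta> * \<delta>) \<le> 0"
      by (simp add: algebra_simps)
    then show False
      using \<open>\<not> D \<le> 0\<close> \<delta> by (simp add: mult_le_0_iff)
  qed
  then have "D = 0"
    using LIMSEQ_le_const[OF D(1)] d0 by force
  obtain c where c: "(\<lambda>t. lo (?y t)) \<longlonglongrightarrow> c"
  proof (rule incseq_convergent[OF inc, of "hi (?y 0)"])
    show "\<forall>t. lo (?y t) \<le> hi (?y 0)"
      using decseqD[OF dec, of 0] lohi order_trans by blast
  qed blast
  have "(\<lambda>t. lo (?y t) + d t) \<longlonglongrightarrow> c + 0"
    by (intro tendsto_add c) (use D \<open>D = 0\<close> in simp)
  then have c': "(\<lambda>t. hi (?y t)) \<longlonglongrightarrow> c"
    by (simp add: d_def)
  have "(\<lambda>t. ?y t v) \<longlonglongrightarrow> c" if "v \<in> V" for v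
    by (rule real_tendsto_sandwich[OF _ _ c c']) (simp_all add: lo_le le_hi that)
  then show ?thesis
    by blast
qed

end

section \<open>Recurrence of finite words in an independent edge sequence\<close>

lemma AE_edge_process_in_support: "AE e in edge_process p. \<forall>t. e t \<in> set_pmf p"
proof -
  have "AE e in edge_process p. e t \<in> set_pmf p" for t
    unfolding edge_process_def
    by (rule AE_PiM_component) (auto simp: measure_pmf.prob_space_axioms AE_measure_pmf)
  then show ?thesis
    by (simp add: AE_all_countable)
qed

text \<open>Blocks are one step longer than the word, so that even for the empty word their starting
  times are unbounded.\<close>
lemma AE_edge_process_word_recurs:
  assumes w: "set w \<subseteq> set_pmf p"
  shows "AE e in edge_process p. infinite {k. \<forall>i<length w. e (k * Suc (length w) + i) = w ! i}"
proof -
  let ?L = "Suc (length w)"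
  interpret product_prob_space "\<lambda>_::nat. measure_pmf p" UNIV
    by unfold_locales
  let ?M = "PiM UNIV (\<lambda>_::nat. measure_pmf p)"
  define K where "K k = {k * ?L ..< k * ?L + length w}" for k :: nat
  define F where "F k = {e \<in> space ?M. \<forall>i<length w. e (k * ?L + i) = w ! i}" for k
  define q where "q t = pmf p (w ! (t mod ?L))" for t
  have F_eq: "F k = {e \<in> space ?M. \<forall>t\<in>K k. e t \<in> {w ! (t mod ?L)}}" for k
  proof -
    have "(\<forall>i<length w. e (k * ?L + i) = w ! i) \<longleftrightarrow> (\<forall>t\<in>K k. e t = w ! (t mod ?L))" for e
    proof -
      have "K k = (\<lambda>i. k * ?L + i) ` {..<length w}"
        unfolding K_def by (simp add: lessThan_atLeast0 add.commute)
      moreover have "(k * ?L + i) mod ?L = i" if "i < length w" for i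
        using that by (metis less_Suc_eq mod_less mod_mult_self3)
      ultimately show ?thesis
        by auto
    qed
    then show ?thesis
      by (simp add: F_def)
  qed
  have disj: "K k \<inter> K l = {}" if "k \<noteq> l" for k l
  proof -
    have "t div ?L = k" if "t \<in> K k" for t k
    proof (rule div_nat_eqI)
      show "?L * k \<le> t" "t < ?L * Suc k"
        using that by (auto simp: K_def algebra_simps)
    qed
    with that show ?thesis
      by blast
  qed
  \<comment> \<open>A finite intersection of block events is a cylinder over the union of the
    blocks; since the blocks are disjoint, its probability factorizes, which yields
    independence.\<close>
  have prob: "prob (\<Inter>k\<in>J. F k) = (\<Prod>k\<in>J. \<Prod>t\<in>K k. q t)" if "finite J" "J \<noteq> {}" for J
  proof -
    have "(\<Inter>k\<in>J. F k) = {e \<in> space ?M. \<forall>t\<in>(\<Union>k\<in>J. K k). e t \<in> {w ! (t mod ?L)}}"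
      using that by (auto simp: F_eq)
    also have "\<dots> = prod_emb UNIV (\<lambda>_. measure_pmf p) (\<Union>k\<in>J. K k) (\<Pi>\<^sub>E t\<in>(\<Union>k\<in>J. K k). {w ! (t mod ?L)})"
      by (auto simp: prod_emb_def space_PiM Pi_iff)
    also have "prob \<dots> = (\<Prod>t\<in>(\<Union>k\<in>J. K k). q t)"
      unfolding q_def pmf.rep_eq using that
      by (intro measure_PiM_emb) (auto simp: K_def)
    also have "\<dots> = (\<Prod>k\<in>J. \<Prod>t\<in>K k. q t)"
      using that disj by (intro prod.UNION_disjoint) (auto simp: K_def)
    finally show ?thesis .
  qed
  have q_eq: "(\<Prod>t\<in>K k. q t) = (\<Prod>i<length w. pmf p (w ! i))" for k
  proof -
    have "(\<Prod>t\<in>K k. q t) = (\<Prod>i<length w. q (i + k * ?L))"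
      unfolding K_def using prod.shift_bounds_nat_ivl[of q 0 "k * ?L" "length w"]
      by (simp add: lessThan_atLeast0 add.commute)
    also have "\<dots> = (\<Prod>i<length w. pmf p (w ! i))"
      unfolding q_def by (intro prod.cong refl) (metis lessThan_iff less_Suc_eq mod_less mod_mult_self1)
    finally show ?thesis .
  qed
  have F_prob: "prob (F k) = (\<Prod>t\<in>K k. q t)" for k
    using prob[of "{k}"] by simp
  have F_sets [measurable]: "F k \<in> events" for k
    unfolding F_eq by (intro sets.sets_Collect_finite_All sets_Collect_single') (auto simp: K_def)
  have indep: "indep_events F UNIV"
    unfolding indep_events_def using F_sets F_prob prob by auto
  define c where "c = (\<Prod>i<length w. pmf p (w ! i))"
  have "0 < c"
    unfolding c_def using w by (intro prod_pos) (auto simp: pmf_positive_iff intro: nth_mem)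
  \<comment> \<open>Every tail union contains a block event of probability \<open>c\<close>, so the
    limit superior has probability at least \<open>c > 0\<close>; the zero-one law then leaves only
    1.\<close>
  have "c \<le> prob (\<Union>m\<in>{n..}. F m)" for n
    using finite_measure_mono[of "F n" "\<Union>m\<in>{n..}. F m"] F_prob[of n] q_eq[of n] by (auto simp: c_def)
  moreover have "(\<lambda>n. prob (\<Union>m\<in>{n..}. F m)) \<longlonglongrightarrow> prob (\<Inter>n. \<Union>m\<in>{n..}. F m)"
    by (intro finite_Lim_measure_decseq decseq_SucI) (auto dest: Suc_leD)
  ultimately have "c \<le> prob (\<Inter>n. \<Union>m\<in>{n..}. F m)"
    by (meson LIMSEQ_le_const)
  then have "prob (\<Inter>n. \<Union>m\<in>{n..}. F m) = 1"
    using borel_0_1_law[OF indep] \<open>0 < c\<close> by auto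
  then have "AE e in ?M. e \<in> (\<Inter>n. \<Union>m\<in>{n..}. F m)"
    by (subst (asm) prob_eq_1) auto
  then show ?thesis
    unfolding edge_process_def
    by eventually_elim (auto simp: F_def infinite_nat_iff_unbounded_le)
qed

lemma (in gossip_network) AE_consensus:
  assumes "set_pmf p = E"
  shows "AE e in edge_process p. \<forall>m\<in>V. \<exists>c. \<forall>v\<in>V. (\<lambda>t. gossip b h (indicator {m}) e t v) \<longlonglongrightarrow> c"
proof -
  obtain w \<delta> where w: "set w \<subseteq> E" "0 < \<delta>" and contr:
    "\<And>y. hi (fold (gossip_step b h) w y) - lo (fold (gossip_step b h) w y) \<le> (1 - \<delta>) * (hi y - lo y)"
    using ex_contracting_word by blast
  show ?thesis
    using AE_edge_process_in_support[of p] AE_edge_process_word_recurs[of w p] w(1) assms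
    by (auto elim!: eventually_elim2 intro!: consensus_if_word_recurs[OF _ w(2) contr])
qed

section \<open>Optimal transport between sorted empirical measures\<close>

declare One_nat_def [simp del]

abbreviation uniform_index :: "nat \<Rightarrow> nat measure" where
  "uniform_index N \<equiv> measure_pmf (pmf_of_set {1..N})"

definition diag_plan :: "nat \<Rightarrow> (nat \<Rightarrow> real) \<Rightarrow> (nat \<Rightarrow> real) \<Rightarrow> (real \<times> real) measure" where
  "diag_plan N x y = distr (uniform_index N) (borel \<Otimes>\<^sub>M borel) (\<lambda>j. (x j, y j))"

text \<open>As the image of a uniformly drawn index, the measure inherits the integration rules of
  \<open>distr\<close>, and drawing one index for two atom vectors gives the coupling
  \<open>diag_plan\<close>.\<close>

lemma empirical_eq_distr:
  assumes "N \<ge> 1"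
  shows "empirical N x = distr (uniform_index N) borel x"
proof (rule measure_eqI)
  fix A assume "A \<in> sets (empirical N x)"
  then have A: "A \<in> sets borel" by simp
  have "(\<Sum>j=1..N. emeasure (return borel (x j)) A) = (\<Sum>j=1..N. ennreal (indicator A (x j)))"
    using A by (intro sum.cong) (auto simp: indicator_def)
  also have "\<dots> = ennreal (card {j \<in> {1..N}. x j \<in> A})"
    by (subst sum_ennreal) (simp_all add: indicator_def sum.If_cases Int_def)
  finally have "emeasure (empirical N x) A = ennreal (card {j \<in> {1..N}. x j \<in> A} / real N)"
    using A by (simp add: emeasure_empirical ennreal_mult'[symmetric] del: ennreal_of_nat_eq_real_of_nat)
  also have "\<dots> = emeasure (distr (uniform_index N) borel x) A"
    using A assms by (simp add: emeasure_distr emeasure_pmf_of_set Int_def vimage_def)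
  finally show "emeasure (empirical N x) A = emeasure (distr (uniform_index N) borel x) A" .
qed simp

lemma prob_space_empirical: "N \<ge> 1 \<Longrightarrow> prob_space (empirical N x)"
  by (simp add: empirical_eq_distr measure_pmf.prob_space_distr)

lemma integrable_uniform_index [simp]:
  fixes f :: "nat \<Rightarrow> real"
  shows "N \<ge> 1 \<Longrightarrow> integrable (uniform_index N) f"
  by (intro integrable_measure_pmf_finite) simp

lemma integrable_empirical:
  fixes f :: "real \<Rightarrow> real"
  shows "N \<ge> 1 \<Longrightarrow> f \<in> borel_measurable borel \<Longrightarrow> integrable (empirical N x) f"
  by (simp add: empirical_eq_distr integrable_distr_eq)

lemma integral_empirical:
  fixes f :: "real \<Rightarrow> real"
  shows "N \<ge> 1 \<Longrightarrow> f \<in> borel_measurable borel \<Longrightarrow>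
    (\<integral>t. f t \<partial>empirical N x) = (\<Sum>j=1..N. f (x j)) / real N"
  by (simp add: empirical_eq_distr integral_distr integral_pmf_of_set)

lemma empirical_in_P2: "N \<ge> 1 \<Longrightarrow> empirical N x \<in> P2"
  by (simp add: P2_def prob_space_empirical integrable_empirical)

lemma AE_empirical:
  assumes "N \<ge> 1"
  shows "AE t in empirical N x. t \<in> x ` {1..N}"
proof -
  have "x ` {1..N} \<in> sets borel"
    by (simp add: borel_closed finite_imp_closed)
  then show ?thesis
    unfolding empirical_eq_distr[OF assms] using assms
    by (subst AE_distr_iff) (simp_all add: AE_measure_pmf_iff)
qed

section \<open>Couplings and duality\<close>

lemma diag_plan_coupling:
  assumes "N \<ge> 1"
  shows "diag_plan N x y \<in> couplings (empirical N x) (empirical N y)"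
proof -
  have "(\<lambda>j. (x j, y j)) \<in> measurable (uniform_index N) (borel \<Otimes>\<^sub>M borel)"
    by (simp add: space_pair_measure)
  then show ?thesis
    using assms by (simp add: diag_plan_def couplings_def empirical_eq_distr distr_distr comp_def)
qed

lemma transport_cost_diag_plan:
  assumes "N \<ge> 1"
  shows "transport_cost (diag_plan N x y) = ennreal ((\<Sum>j=1..N. (x j - y j)\<^sup>2) / real N)"
proof -
  have pair: "(\<lambda>j. (x j, y j)) \<in> measurable (uniform_index N) (borel \<Otimes>\<^sub>M borel)"
    by (simp add: space_pair_measure)
  have "transport_cost (diag_plan N x y) = (\<integral>\<^sup>+j. ennreal ((x j - y j)\<^sup>2) \<partial>uniform_index N)"
    unfolding transport_cost_def diag_plan_def by (subst nn_integral_distr[OF pair]) simp_all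
  also have "\<dots> = ennreal (\<integral>j. (x j - y j)\<^sup>2 \<partial>uniform_index N)"
    using assms by (intro nn_integral_eq_integral) simp_all
  also have "(\<integral>j. (x j - y j)\<^sup>2 \<partial>uniform_index N) = (\<Sum>j=1..N. (x j - y j)\<^sup>2) / real N"
    using assms by (simp add: integral_pmf_of_set)
  finally show ?thesis .
qed

lemma W2_empirical_le:
  assumes "N \<ge> 1"
  shows "(W2 (empirical N x) (empirical N y))\<^sup>2 \<le> (\<Sum>j=1..N. (x j - y j)\<^sup>2) / real N"
proof -
  have "(\<Sqinter>\<gamma>\<in>couplings (empirical N x) (empirical N y). transport_cost \<gamma>)
      \<le> ennreal ((\<Sum>j=1..N. (x j - y j)\<^sup>2) / real N)"
    by (rule INF_lower2[OF diag_plan_coupling[OF assms]]) (simp add: transport_cost_diag_plan assms)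
  then show ?thesis
    unfolding W2_def by (simp add: enn2real_leI sum_nonneg)
qed

text \<open>Potentials are prescribed at atoms only; an empirical marginal does not see their values
  elsewhere, so any Borel extension will do. Injectivity makes the prescription consistent.\<close>

lemma ex_borel_extension:
  fixes y f :: "nat \<Rightarrow> real"
  assumes "inj_on y {1..N}"
  obtains g where "g \<in> borel_measurable borel" "\<And>k. k \<in> {1..N} \<Longrightarrow> g (y k) = f k"
proof
  define g where "g t = (\<Sum>k\<in>{1..N}. f k * indicator {y k} t)" for t
  show "g \<in> borel_measurable borel"
    unfolding g_def by measurable
  show "g (y k) = f k" if "k \<in> {1..N}" for k
  proof -
    have "g (y k) = (\<Sum>l\<in>{1..N}. if l = k then f l else 0)"
      unfolding g_def using assms that by (intro sum.cong) (auto simp: indicator_def inj_on_eq_iff)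
    then show ?thesis
      using that by simp
  qed
qed

text \<open>Kantorovich duality, with the slack of a pair of potentials as the gap.\<close>
lemma coupling_duality:
  fixes u :: "real \<Rightarrow> real"
  assumes N: "N \<ge> 1" and \<mu>: "\<mu> \<in> P2" and \<gamma>: "\<gamma> \<in> couplings \<mu> (empirical N x)"
    and u [measurable]: "u \<in> borel_measurable borel" and int_u: "integrable \<mu> u"
    and g [measurable]: "g \<in> borel_measurable borel" and gw: "\<And>k. k \<in> {1..N} \<Longrightarrow> g (x k) = w k"
  shows "integrable \<gamma> (\<lambda>p. u (fst p) + g (snd p) - fst p * snd p)"
    and "transport_cost \<gamma> = ennreal ((\<integral>t. t\<^sup>2 - 2 * u t \<partial>\<mu>) + (\<Sum>k=1..N. (x k)\<^sup>2 - 2 * w k) / real N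
          + 2 * (\<integral>p. u (fst p) + g (snd p) - fst p * snd p \<partial>\<gamma>))"
proof -
  have [measurable_cong]: "sets \<gamma> = sets (borel \<Otimes>\<^sub>M borel)" "sets \<mu> = sets borel"
    using \<gamma> \<mu> by (auto simp: couplings_def P2_def)
  have d: "distr \<gamma> borel fst = \<mu>" "distr \<gamma> borel snd = empirical N x"
    using \<gamma> by (auto simp: couplings_def)
  have int_fst: "integrable \<gamma> (\<lambda>p. f (fst p)) \<longleftrightarrow> integrable \<mu> f" if [measurable]: "f \<in> borel_measurable borel" for f :: "real \<Rightarrow> real"
    unfolding d(1)[symmetric] by (subst integrable_distr_eq) simp_all
  have integral_fst: "(\<integral>p. f (fst p) \<partial>\<gamma>) = (\<integral>t. f t \<partial>\<mu>)" if [measurable]: "f \<in> borel_measurable borel" for f :: "real \<Rightarrow> real"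
    unfolding d(1)[symmetric] by (subst integral_distr) simp_all
  have int_snd: "integrable \<gamma> (\<lambda>p. f (snd p))" if [measurable]: "f \<in> borel_measurable borel" for f :: "real \<Rightarrow> real"
    using integrable_empirical[OF N that, of x] unfolding d(2)[symmetric] by (subst (asm) integrable_distr_eq) simp_all
  have integral_snd: "(\<integral>p. f (snd p) \<partial>\<gamma>) = (\<Sum>k=1..N. f (x k)) / real N" if [measurable]: "f \<in> borel_measurable borel" for f :: "real \<Rightarrow> real"
    unfolding integral_empirical[OF N that, symmetric] d(2)[symmetric] by (subst integral_distr) simp_all
  have i1: "integrable \<gamma> (\<lambda>p. (fst p)\<^sup>2)"
    using int_fst[of "\<lambda>t. t\<^sup>2"] \<mu> by (simp add: P2_def)
  have i2: "integrable \<gamma> (\<lambda>p. (snd p)\<^sup>2)"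
    using int_snd[of "\<lambda>t. t\<^sup>2"] by simp
  have i3: "integrable \<gamma> (\<lambda>p. fst p * snd p)"
  proof (rule Bochner_Integration.integrable_bound[OF Bochner_Integration.integrable_add[OF i1 i2]])
    show "AE p in \<gamma>. norm (fst p * snd p) \<le> norm ((fst p)\<^sup>2 + (snd p)\<^sup>2)"
    proof (rule AE_I2)
      fix p :: "real \<times> real"
      have "0 \<le> (\<bar>fst p\<bar> - \<bar>snd p\<bar>)\<^sup>2" by simp
      then have "2 * (\<bar>fst p\<bar> * \<bar>snd p\<bar>) \<le> (fst p)\<^sup>2 + (snd p)\<^sup>2"
        by (simp add: power2_diff)
      moreover have "0 \<le> \<bar>fst p\<bar> * \<bar>snd p\<bar>" by simp
      ultimately show "norm (fst p * snd p) \<le> norm ((fst p)\<^sup>2 + (snd p)\<^sup>2)"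
        unfolding real_norm_def abs_mult by linarith
    qed
  qed simp
  have iu: "integrable \<gamma> (\<lambda>p. u (fst p))" and ig: "integrable \<gamma> (\<lambda>p. g (snd p))"
    using int_fst int_u int_snd by simp_all
  show int_slack: "integrable \<gamma> (\<lambda>p. u (fst p) + g (snd p) - fst p * snd p)"
    using iu ig i3 by simp
  define s where "s p = u (fst p) + g (snd p) - fst p * snd p" for p
  \<comment> \<open>The first two summands involve one coordinate each, so their integrals are fixed
    by the marginals; only the slack varies with the coupling.\<close>
  have split: "(fst p - snd p)\<^sup>2 = ((fst p)\<^sup>2 - 2 * u (fst p)) + ((snd p)\<^sup>2 - 2 * g (snd p)) + 2 * s p" for p
    by (simp add: s_def power2_diff)
  have iu': "integrable \<gamma> (\<lambda>p. (fst p)\<^sup>2 - 2 * u (fst p))" and ig': "integrable \<gamma> (\<lambda>p. (snd p)\<^sup>2 - 2 * g (snd p))"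
    and int_s: "integrable \<gamma> s"
    using i1 i2 iu ig int_slack by (simp_all add: s_def[abs_def])
  have "transport_cost \<gamma> = ennreal (\<integral>p. (fst p - snd p)\<^sup>2 \<partial>\<gamma>)"
    unfolding transport_cost_def case_prod_beta power2_abs
  proof (rule nn_integral_eq_integral)
    show "integrable \<gamma> (\<lambda>p. (fst p - snd p)\<^sup>2)"
      unfolding split using iu' ig' int_s by simp
  qed simp
  also have "(\<integral>p. (fst p - snd p)\<^sup>2 \<partial>\<gamma>) =
      (\<integral>p. (fst p)\<^sup>2 - 2 * u (fst p) \<partial>\<gamma>) + (\<integral>p. (snd p)\<^sup>2 - 2 * g (snd p) \<partial>\<gamma>) + 2 * (\<integral>p. s p \<partial>\<gamma>)"
    unfolding split using iu' ig' int_s by simp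
  also have "(\<integral>p. (fst p)\<^sup>2 - 2 * u (fst p) \<partial>\<gamma>) = (\<integral>t. t\<^sup>2 - 2 * u t \<partial>\<mu>)"
    by (rule integral_fst) simp
  also have "(\<integral>p. (snd p)\<^sup>2 - 2 * g (snd p) \<partial>\<gamma>) = (\<Sum>k=1..N. (x k)\<^sup>2 - 2 * w k) / real N"
    by (subst integral_snd) (simp_all add: gw)
  finally show "transport_cost \<gamma> = ennreal ((\<integral>t. t\<^sup>2 - 2 * u t \<partial>\<mu>) + (\<Sum>k=1..N. (x k)\<^sup>2 - 2 * w k) / real N
          + 2 * (\<integral>p. u (fst p) + g (snd p) - fst p * snd p \<partial>\<gamma>))"
    by (simp add: s_def)
qed

text \<open>Discrete Legendre potential of the increasing assignment \<open>z k \<mapsto> x k\<close>: the convex function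
  \<open>\<lambda>t. max\<^sub>k (x k * t - w k)\<close> has slope \<open>x k\<close> on the Voronoi cell of \<open>z k\<close>.\<close>
definition dual_weight :: "real \<Rightarrow> (nat \<Rightarrow> real) \<Rightarrow> (nat \<Rightarrow> real) \<Rightarrow> nat \<Rightarrow> real" where
  "dual_weight c z x k = c + (\<Sum>l=1..<k. (x (Suc l) - x l) * (z l + z (Suc l)) / 2)"

lemma dual_weight_diff:
  assumes "1 \<le> j" "j \<le> k"
  shows "dual_weight c z x k - dual_weight c z x j = (\<Sum>l=j..<k. (x (Suc l) - x l) * (z l + z (Suc l)) / 2)"
  using sum.atLeastLessThan_concat[of 1 j k "\<lambda>l. (x (Suc l) - x l) * (z l + z (Suc l)) / 2"] assms
  by (simp add: dual_weight_def)

text \<open>Telescoping. For increasing \<open>x\<close>, the summand for \<open>l\<close> changes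
  sign exactly where \<open>t\<close> crosses the midpoint of \<open>z l\<close> and
  \<open>z (Suc l)\<close>.\<close>

lemma affine_gap:
  assumes "1 \<le> j" "j \<le> k"
  shows "(x k * t - dual_weight c z x k) - (x j * t - dual_weight c z x j)
       = (\<Sum>l=j..<k. (x (Suc l) - x l) * (t - (z l + z (Suc l)) / 2))"
proof -
  have "(x k - x j) * t = (\<Sum>l=j..<k. (x (Suc l) - x l) * t)"
    using assms(2) by (simp add: sum_Suc_diff' sum_distrib_right[symmetric])
  then have "(x k * t - dual_weight c z x k) - (x j * t - dual_weight c z x j)
       = (\<Sum>l=j..<k. (x (Suc l) - x l) * t) - (\<Sum>l=j..<k. (x (Suc l) - x l) * (z l + z (Suc l)) / 2)"
    using dual_weight_diff[OF assms, of c z x] by (simp add: algebra_simps)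
  also have "\<dots> = (\<Sum>l=j..<k. (x (Suc l) - x l) * (t - (z l + z (Suc l)) / 2))"
    by (simp add: sum_subtractf[symmetric] algebra_simps)
  finally show ?thesis .
qed

lemma strict_mono_on_Suc_less:
  fixes x :: "nat \<Rightarrow> real"
  shows "strict_mono_on {1..N} x \<Longrightarrow> 1 \<le> l \<Longrightarrow> l < N \<Longrightarrow> x l < x (Suc l)"
  by (auto intro: strict_mono_onD)

lemma strict_mono_on_imp_le:
  fixes x :: "nat \<Rightarrow> real"
  shows "strict_mono_on {1..N} x \<Longrightarrow> 1 \<le> l \<Longrightarrow> l \<le> m \<Longrightarrow> m \<le> N \<Longrightarrow> x l \<le> x m"
  using strict_mono_onD[of "{1..N}" x l m] by (cases "l = m") auto

text \<open>For \<open>j < k\<close>, being no farther from \<open>z j\<close> than from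
  \<open>z (Suc j)\<close> keeps \<open>t\<close> from lying right of their midpoint, hence right of
  any later one, so no summand of the gap is positive; \<open>k < j\<close> is symmetric. Which
  index wins depends on \<open>z\<close> alone, not on the slopes.\<close>

lemma nearest_atom_maximizes:
  assumes z: "strict_mono_on {1..N} z" and x: "strict_mono_on {1..N} x"
    and j: "j \<in> {1..N}" and k: "k \<in> {1..N}"
    and near: "\<And>l. l \<in> {1..N} \<Longrightarrow> \<bar>t - z j\<bar> \<le> \<bar>t - z l\<bar>"
  shows "x k * t - dual_weight c z x k \<le> x j * t - dual_weight c z x j"
proof (cases "j \<le> k")
  case True
  have "(\<Sum>l=j..<k. (x (Suc l) - x l) * (t - (z l + z (Suc l)) / 2)) \<le> 0"
  proof (intro sum_nonpos mult_nonneg_nonpos)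
    fix l assume l: "l \<in> {j..<k}"
    with j k have *: "1 \<le> l" "l < N" "Suc j \<le> N" by auto
    show "0 \<le> x (Suc l) - x l"
      using strict_mono_on_Suc_less[OF x *(1,2)] by simp
    have "z j < z (Suc j)" "\<bar>t - z j\<bar> \<le> \<bar>t - z (Suc j)\<bar>" "z j \<le> z l" "z (Suc j) \<le> z (Suc l)"
      using strict_mono_on_Suc_less[OF z, of j] near[of "Suc j"] strict_mono_on_imp_le[OF z] j l * by auto
    then show "t - (z l + z (Suc l)) / 2 \<le> 0"
      by (auto simp: abs_if split: if_splits)
  qed
  with True j show ?thesis
    using affine_gap[of j k x t c z] by simp
next
  case False
  have "0 \<le> (\<Sum>l=k..<j. (x (Suc l) - x l) * (t - (z l + z (Suc l)) / 2))"
  proof (intro sum_nonneg mult_nonneg_nonneg)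
    fix l assume l: "l \<in> {k..<j}"
    define i where "i = j - 1"
    have i: "j = Suc i" "i \<in> {1..N}" "l \<le> i"
      using l j k by (auto simp: i_def)
    with l j k have *: "1 \<le> l" "l < N" by auto
    show "0 \<le> x (Suc l) - x l"
      using strict_mono_on_Suc_less[OF x *] by simp
    have "z i < z j" "\<bar>t - z j\<bar> \<le> \<bar>t - z i\<bar>" "z l \<le> z i" "z (Suc l) \<le> z j"
      using strict_mono_on_Suc_less[OF z, of i] near[of i] strict_mono_on_imp_le[OF z] j i * by auto
    then show "0 \<le> t - (z l + z (Suc l)) / 2"
      by (auto simp: abs_if split: if_splits)
  qed
  with False k show ?thesis
    using affine_gap[of k j x t c z] by simp
qed

text \<open>An atom lies strictly on one side of every midpoint, so no summand of the gap vanishes.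
  This strictness is the source of the uniqueness of the optimal plan.\<close>

lemma atom_maximizes_strictly:
  assumes z: "strict_mono_on {1..N} z" and x: "strict_mono_on {1..N} x"
    and j: "j \<in> {1..N}" and k: "k \<in> {1..N}" and "j \<noteq> k"
  shows "x k * z j - dual_weight c z x k < x j * z j - dual_weight c z x j"
proof (cases "j < k")
  case True
  have "(\<Sum>l=j..<k. (x (Suc l) - x l) * (z j - (z l + z (Suc l)) / 2)) < (\<Sum>l=j..<k. 0)"
  proof (rule sum_strict_mono)
    fix l assume l: "l \<in> {j..<k}"
    with j k have *: "1 \<le> l" "l < N" by auto
    have "z j \<le> z l"
      using l * j by (intro strict_mono_on_imp_le[OF z]) auto
    then show "(x (Suc l) - x l) * (z j - (z l + z (Suc l)) / 2) < 0"
      using strict_mono_on_Suc_less[OF x *] strict_mono_on_Suc_less[OF z *] by (simp add: mult_pos_neg)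
  qed (use True in auto)
  with True j show ?thesis
    using affine_gap[of j k x "z j" c z] by simp
next
  case False
  have "(\<Sum>l=k..<j. 0) < (\<Sum>l=k..<j. (x (Suc l) - x l) * (z j - (z l + z (Suc l)) / 2))"
  proof (rule sum_strict_mono)
    fix l assume l: "l \<in> {k..<j}"
    with j k have *: "1 \<le> l" "l < N" by auto
    have "z (Suc l) \<le> z j"
      using l * j by (intro strict_mono_on_imp_le[OF z]) auto
    then show "0 < (x (Suc l) - x l) * (z j - (z l + z (Suc l)) / 2)"
      using strict_mono_on_Suc_less[OF x *] strict_mono_on_Suc_less[OF z *] by simp
  qed (use False \<open>j \<noteq> k\<close> in auto)
  with False k show ?thesis
    using affine_gap[of k j x "z j" c z] by simp
qed

section \<open>The unique optimal plan between sorted atoms\<close>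

lemma coupling_AE_support:
  assumes "\<gamma> \<in> couplings (empirical N x) (empirical N y)" "N \<ge> 1"
  shows "AE p in \<gamma>. fst p \<in> x ` {1..N} \<and> snd p \<in> y ` {1..N}"
proof -
  have [measurable_cong]: "sets \<gamma> = sets (borel \<Otimes>\<^sub>M borel)"
    and d: "distr \<gamma> borel fst = empirical N x" "distr \<gamma> borel snd = empirical N y"
    using assms by (auto simp: couplings_def)
  have "AE p in \<gamma>. fst p \<in> x ` {1..N}"
    by (rule AE_distrD[of fst \<gamma> borel]) (use AE_empirical[OF assms(2), of x] in \<open>simp_all only: d, simp\<close>)
  moreover have "AE p in \<gamma>. snd p \<in> y ` {1..N}"
    by (rule AE_distrD[of snd \<gamma> borel]) (use AE_empirical[OF assms(2), of y] in \<open>simp_all only: d, simp\<close>)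
  ultimately show ?thesis
    by eventually_elim auto
qed

text \<open>A coupling carried by the graph of a map is the image of its first marginal and hence
  determined by it.\<close>

lemma coupling_snd_AE_function_of_fst:
  assumes N: "N \<ge> 1" and \<gamma>: "\<gamma> \<in> couplings (empirical N x) (empirical N y)"
    and T [measurable]: "T \<in> borel_measurable borel" and Tx: "\<And>j. j \<in> {1..N} \<Longrightarrow> T (x j) = y j"
    and AE: "AE p in \<gamma>. snd p = T (fst p)"
  shows "\<gamma> = diag_plan N x y"
proof -
  have s: "sets \<gamma> = sets (borel \<Otimes>\<^sub>M borel)" and d: "distr \<gamma> borel fst = empirical N x"
    using \<gamma> by (auto simp: couplings_def)
  note [measurable_cong] = s
  let ?B = "borel \<Otimes>\<^sub>M borel :: (real \<times> real) measure"
  have "\<gamma> = distr \<gamma> ?B (\<lambda>p. p)"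
    by (rule distr_id2[symmetric]) (simp add: s)
  also have "\<dots> = distr \<gamma> ?B (\<lambda>p. (fst p, T (fst p)))"
    by (rule distr_cong_AE) (use AE in \<open>auto simp: prod_eq_iff\<close>)
  also have "\<dots> = distr (empirical N x) ?B (\<lambda>t. (t, T t))"
    unfolding d[symmetric] by (subst distr_distr) (simp_all add: comp_def)
  also have "\<dots> = distr (uniform_index N) ?B (\<lambda>j. (x j, T (x j)))"
    unfolding empirical_eq_distr[OF N] by (subst distr_distr) (simp_all add: comp_def)
  also have "\<dots> = diag_plan N x y"
    unfolding diag_plan_def
    by (rule distr_cong_AE) (use N in \<open>auto simp: AE_measure_pmf_iff Tx space_pair_measure\<close>)
  finally show ?thesis .
qed

text \<open>Since \<open>gamma_opt\<close> is a choice, uniqueness matters as much as optimality.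
  The cost is a constant plus twice the mean slack, and on pairs of atoms the slack is nonnegative
  and vanishes only for equal indices; so a minimizer has zero slack almost everywhere.\<close>

lemma optimal_plan_sorted_iff:
  assumes N: "N \<ge> 1" and x: "strict_mono_on {1..N} x" and y: "strict_mono_on {1..N} y"
  shows "optimal_plan (empirical N x) (empirical N y) \<gamma> \<longleftrightarrow> \<gamma> = diag_plan N x y"
proof -
  let ?\<mu> = "empirical N x" and ?\<nu> = "empirical N y"
  \<comment> \<open>Here \<open>x\<close> supplies the breakpoints and \<open>y\<close> the slopes;
    the additive constant 0 is arbitrary, as it cancels in the slack.\<close>
  define w where "w = dual_weight 0 x y"
  obtain u where u: "u \<in> borel_measurable borel" "\<And>j. j \<in> {1..N} \<Longrightarrow> u (x j) = y j * x j - w j"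
    using ex_borel_extension[OF strict_mono_on_imp_inj_on[OF x], of "\<lambda>j. y j * x j - w j"] by metis
  obtain g where g: "g \<in> borel_measurable borel" "\<And>k. k \<in> {1..N} \<Longrightarrow> g (y k) = w k"
    using ex_borel_extension[OF strict_mono_on_imp_inj_on[OF y], of w] by metis
  obtain T where T: "T \<in> borel_measurable borel" "\<And>j. j \<in> {1..N} \<Longrightarrow> T (x j) = y j"
    using ex_borel_extension[OF strict_mono_on_imp_inj_on[OF x], of y] by metis
  define slack where "slack p = u (fst p) + g (snd p) - fst p * snd p" for p
  define K where "K = (\<integral>t. t\<^sup>2 - 2 * u t \<partial>?\<mu>) + (\<Sum>k=1..N. (y k)\<^sup>2 - 2 * w k) / real N"
  have slack_eq: "slack (x j, y k) = (y j * x j - w j) - (y k * x j - w k)" if "j \<in> {1..N}" "k \<in> {1..N}" for j k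
    using that u g by (simp add: slack_def)
  have slack_pos: "0 < slack (x j, y k)" if "j \<in> {1..N}" "k \<in> {1..N}" "j \<noteq> k" for j k
    unfolding slack_eq[OF that(1,2)] w_def using atom_maximizes_strictly[OF x y that, of 0] by simp
  have slack_diag: "slack (x j, y j) = 0" if "j \<in> {1..N}" for j
    using slack_eq[OF that that] by simp
  have slack_cases: "0 \<le> slack p \<and> (slack p = 0 \<longrightarrow> snd p = T (fst p))"
    if "fst p \<in> x ` {1..N} \<and> snd p \<in> y ` {1..N}" for p
  proof -
    from that obtain j k where jk: "j \<in> {1..N}" "k \<in> {1..N}" "p = (x j, y k)"
      by (cases p) auto
    then show ?thesis
      using slack_pos[of j k] slack_diag[of j] T(2)[of j] by (cases "j = k") auto
  qed
  have cost: "transport_cost \<gamma> = ennreal (K + 2 * (\<integral>p. slack p \<partial>\<gamma>))" "integrable \<gamma> slack"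
    "AE p in \<gamma>. 0 \<le> slack p" "0 \<le> (\<integral>p. slack p \<partial>\<gamma>)"
    if \<gamma>: "\<gamma> \<in> couplings ?\<mu> ?\<nu>" for \<gamma>
  proof -
    show "transport_cost \<gamma> = ennreal (K + 2 * (\<integral>p. slack p \<partial>\<gamma>))"
      unfolding K_def slack_def
      by (rule coupling_duality(2)[OF N empirical_in_P2[OF N] \<gamma>])
         (use u g N in \<open>auto intro: integrable_empirical\<close>)
    show "integrable \<gamma> slack"
      unfolding slack_def[abs_def]
      by (rule coupling_duality(1)[OF N empirical_in_P2[OF N] \<gamma>])
         (use u g N in \<open>auto intro: integrable_empirical\<close>)
    show "AE p in \<gamma>. 0 \<le> slack p"
      using coupling_AE_support[OF \<gamma> N] by eventually_elim (use slack_cases in blast)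
    then show "0 \<le> (\<integral>p. slack p \<partial>\<gamma>)"
      by (rule integral_nonneg_AE)
  qed
  have K: "K = (\<Sum>j=1..N. (x j - y j)\<^sup>2) / real N"
  proof -
    have "(\<integral>t. t\<^sup>2 - 2 * u t \<partial>?\<mu>) = (\<Sum>j=1..N. (x j)\<^sup>2 - 2 * u (x j)) / real N"
      using u by (intro integral_empirical[OF N]) simp
    also have "(\<Sum>j=1..N. (x j)\<^sup>2 - 2 * u (x j)) = (\<Sum>j=1..N. (x j)\<^sup>2 - 2 * (y j * x j - w j))"
      using u by (intro sum.cong) auto
    finally show ?thesis
      unfolding K_def
      by (simp add: add_divide_distrib[symmetric] sum.distrib[symmetric] power2_diff algebra_simps)
  qed
  have cost_diag: "transport_cost (diag_plan N x y) = ennreal K"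
    by (simp add: transport_cost_diag_plan[OF N] K)
  have "0 \<le> K"
    unfolding K by (simp add: sum_nonneg)
  show ?thesis
  proof
    assume opt: "optimal_plan ?\<mu> ?\<nu> \<gamma>"
    then have \<gamma>: "\<gamma> \<in> couplings ?\<mu> ?\<nu>" and "\<not> transport_cost (diag_plan N x y) < transport_cost \<gamma>"
      using diag_plan_coupling[OF N, of x y] by (auto simp: optimal_plan_def is_arg_min_def)
    then have "K + 2 * (\<integral>p. slack p \<partial>\<gamma>) \<le> K"
      using \<open>0 \<le> K\<close> by (simp add: cost_diag cost(1)[OF \<gamma>] not_less)
    then have "(\<integral>p. slack p \<partial>\<gamma>) = 0"
      using cost(4)[OF \<gamma>] by simp
    then have "AE p in \<gamma>. slack p = 0"
      using integral_nonneg_eq_0_iff_AE[OF cost(2,3)[OF \<gamma>]] by simp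
    then have "AE p in \<gamma>. snd p = T (fst p)"
      using coupling_AE_support[OF \<gamma> N] by eventually_elim (use slack_cases in blast)
    then show "\<gamma> = diag_plan N x y"
      by (intro coupling_snd_AE_function_of_fst[OF N \<gamma> T])
  next
    assume "\<gamma> = diag_plan N x y"
    moreover have "\<not> transport_cost \<gamma>' < transport_cost (diag_plan N x y)" if "\<gamma>' \<in> couplings ?\<mu> ?\<nu>" for \<gamma>'
      using cost(4)[OF that] \<open>0 \<le> K\<close> by (simp add: cost_diag cost(1)[OF that] not_less)
    ultimately show "optimal_plan ?\<mu> ?\<nu> \<gamma>"
      using diag_plan_coupling[OF N, of x y] by (auto simp: optimal_plan_def is_arg_min_def)
  qed
qed

lemma displacement_sorted:
  assumes N: "N \<ge> 1" and "strict_mono_on {1..N} x" and "strict_mono_on {1..N} y"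
  shows "displacement a (empirical N x) (empirical N y) = empirical N (\<lambda>j. (1 - a) * x j + a * y j)"
proof -
  have "gamma_opt (empirical N x) (empirical N y) = diag_plan N x y"
    unfolding gamma_opt_def by (rule some_equality) (simp_all add: optimal_plan_sorted_iff[OF assms])
  moreover have "interp a \<in> borel_measurable (borel \<Otimes>\<^sub>M borel)"
    unfolding interp_def case_prod_beta by measurable
  ultimately show ?thesis
    unfolding displacement_def diag_plan_def empirical_eq_distr[OF N]
    by (simp add: distr_distr space_pair_measure comp_def interp_def)
qed

text \<open>Weak duality: the slack is nonnegative wherever the second coordinate is an atom, hence
  almost everywhere for any coupling, so every coupling costs at least \<open>?K\<close>.\<close>

lemma W2_empirical_ge:
  assumes N: "N \<ge> 1" and \<nu>: "\<nu> \<in> P2" and inj: "inj_on x {1..N}"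
    and u: "u \<in> borel_measurable borel" "integrable \<nu> u"
    and le: "\<And>t k. k \<in> {1..N} \<Longrightarrow> x k * t - w k \<le> u t"
  shows "(\<integral>t. t\<^sup>2 - 2 * u t \<partial>\<nu>) + (\<Sum>k=1..N. (x k)\<^sup>2 - 2 * w k) / real N \<le> (W2 \<nu> (empirical N x))\<^sup>2"
    (is "?K \<le> _")
proof -
  obtain g where g: "g \<in> borel_measurable borel" "\<And>k. k \<in> {1..N} \<Longrightarrow> g (x k) = w k"
    using ex_borel_extension[OF inj, of w] by metis
  define slack where "slack p = u (fst p) + g (snd p) - fst p * snd p" for p
  have cost: "transport_cost \<gamma> = ennreal (?K + 2 * (\<integral>p. slack p \<partial>\<gamma>))" "0 \<le> (\<integral>p. slack p \<partial>\<gamma>)"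
    if \<gamma>: "\<gamma> \<in> couplings \<nu> (empirical N x)" for \<gamma>
  proof -
    show "transport_cost \<gamma> = ennreal (?K + 2 * (\<integral>p. slack p \<partial>\<gamma>))"
      unfolding slack_def by (rule coupling_duality(2)[OF N \<nu> \<gamma> u g])
    have [measurable_cong]: "sets \<gamma> = sets (borel \<Otimes>\<^sub>M borel)" and d: "distr \<gamma> borel snd = empirical N x"
      using \<gamma> by (auto simp: couplings_def)
    have "AE p in \<gamma>. snd p \<in> x ` {1..N}"
      by (rule AE_distrD[of snd \<gamma> borel]) (use AE_empirical[OF N, of x] in \<open>simp_all only: d, simp\<close>)
    then have "AE p in \<gamma>. 0 \<le> slack p"
    proof eventually_elim
      case (elim p)
      then obtain k where k: "k \<in> {1..N}" "snd p = x k" by blast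
      then show ?case
        using le[OF k(1), of "fst p"] g(2)[OF k(1)] by (simp add: slack_def algebra_simps)
    qed
    then show "0 \<le> (\<integral>p. slack p \<partial>\<gamma>)"
      by (rule integral_nonneg_AE)
  qed
  interpret \<nu>: prob_space \<nu>
    using \<nu> by (simp add: P2_def)
  interpret \<mu>: prob_space "empirical N x"
    by (rule prob_space_empirical[OF N])
  interpret pair_prob_space \<nu> "empirical N x" ..
  have sets_\<nu>: "sets \<nu> = sets borel"
    using \<nu> by (simp add: P2_def)
  note [measurable_cong] = sets_\<nu> sets_empirical
  \<comment> \<open>The infimum has to be finite, since \<open>enn2real\<close> would send an
    infinite one to 0; the product coupling, whose cost is a real number by \<open>cost\<close>,
    witnesses this.\<close>
  have ne: "\<nu> \<Otimes>\<^sub>M empirical N x \<in> couplings \<nu> (empirical N x)"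
  proof -
    have "distr (\<nu> \<Otimes>\<^sub>M empirical N x) borel fst = distr (\<nu> \<Otimes>\<^sub>M empirical N x) \<nu> fst"
      by (rule distr_cong) (simp_all add: sets_\<nu>)
    moreover have "distr (\<nu> \<Otimes>\<^sub>M empirical N x) borel snd = empirical N x"
    proof -
      have "distr (\<nu> \<Otimes>\<^sub>M empirical N x) borel snd = distr (distr (empirical N x \<Otimes>\<^sub>M \<nu>) (\<nu> \<Otimes>\<^sub>M empirical N x) (\<lambda>(a, b). (b, a))) borel snd"
        using distr_pair_swap by simp
      also have "\<dots> = distr (empirical N x \<Otimes>\<^sub>M \<nu>) borel fst"
        by (subst distr_distr) (simp_all add: comp_def case_prod_beta)
      also have "\<dots> = distr (empirical N x \<Otimes>\<^sub>M \<nu>) (empirical N x) fst"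
        by (rule distr_cong) simp_all
      also have "\<dots> = empirical N x"
        by (rule \<nu>.distr_pair_fst)
      finally show ?thesis .
    qed
    ultimately show ?thesis
      using \<mu>.distr_pair_fst[of \<nu>] sets_\<nu>
      by (simp add: couplings_def cong: sets_pair_measure_cong)
  qed
  let ?I = "\<Sqinter>\<gamma>\<in>couplings \<nu> (empirical N x). transport_cost \<gamma>"
  have "?I \<le> transport_cost (\<nu> \<Otimes>\<^sub>M empirical N x)"
    by (rule INF_lower[OF ne])
  then have "?I < top"
    unfolding cost(1)[OF ne] using ennreal_less_top le_less_trans by blast
  moreover have "ennreal ?K \<le> ?I"
    by (rule INF_greatest) (use cost in \<open>auto intro!: ennreal_leI\<close>)
  ultimately have "enn2real (ennreal ?K) \<le> enn2real ?I"
    by (intro enn2real_mono)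
  \<comment> \<open>A negative \<open>?K\<close> is truncated to 0 by \<open>ennreal\<close>; in
    that case the bound is trivial.\<close>
  then have "?K \<le> enn2real ?I"
    by (cases "0 \<le> ?K") (auto intro: order_trans[OF _ enn2real_nonneg])
  then show ?thesis
    by (simp add: W2_def)
qed

section \<open>Barycenters\<close>

text \<open>For fixed \<open>z\<close>, \<open>dual_weight\<close> is linear in the constant and the
  slopes jointly. Sharing the breakpoints among all agents is what makes averaging possible.\<close>

lemma sum_dual_weight:
  "(\<Sum>i\<in>I. l i * dual_weight (c i) z (x i) k) =
     dual_weight (\<Sum>i\<in>I. l i * c i) z (\<lambda>j. \<Sum>i\<in>I. l i * x i j) k"
proof -
  have "(\<Sum>i\<in>I. l i * (\<Sum>m=1..<k. (x i (Suc m) - x i m) * (z m + z (Suc m)) / 2))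
      = (\<Sum>m=1..<k. \<Sum>i\<in>I. l i * ((x i (Suc m) - x i m) * (z m + z (Suc m)) / 2))"
    unfolding sum_distrib_left by (rule sum.swap)
  also have "\<dots> = (\<Sum>m=1..<k. ((\<Sum>i\<in>I. l i * x i (Suc m)) - (\<Sum>i\<in>I. l i * x i m)) * (z m + z (Suc m)) / 2)"
    unfolding sum_subtractf[symmetric] sum_distrib_right sum_divide_distrib
    by (intro sum.cong refl) (simp add: field_simps)
  finally show ?thesis
    by (simp add: dual_weight_def algebra_simps sum.distrib)
qed

text \<open>With slopes \<open>z\<close> the summands are increments of
  \<open>(z m)\<^sup>2 / 2\<close>: a discrete form of the fact that \<open>t^2 / 2\<close> is its
  own Legendre conjugate.\<close>

lemma dual_weight_self:
  assumes "1 \<le> k"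
  shows "dual_weight ((z 1)\<^sup>2 / 2) z z k = (z k)\<^sup>2 / 2"
proof -
  have "(\<Sum>m=1..<k. (z (Suc m) - z m) * (z m + z (Suc m)) / 2) = (\<Sum>m=1..<k. (z (Suc m))\<^sup>2 / 2 - (z m)\<^sup>2 / 2)"
    by (intro sum.cong) (auto simp: power2_eq_square field_simps)
  also have "\<dots> = (z k)\<^sup>2 / 2 - (z 1)\<^sup>2 / 2"
    using assms sum_Suc_diff'[of 1 k "\<lambda>m. (z m)\<^sup>2 / 2"] by simp
  finally show ?thesis
    by (simp add: dual_weight_def)
qed

lemma convex_combination_strict_mono:
  assumes "convex_vector n l" and "\<And>i. i \<in> {1..n} \<Longrightarrow> strict_mono_on {1..N} (x i)"
  shows "strict_mono_on {1..N} (\<lambda>j. \<Sum>i=1..n. l i * x i j :: real)"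
proof (rule strict_mono_onI)
  fix j k assume jk: "j \<in> {1..N}" "k \<in> {1..N}" "j < k"
  have less: "x i j < x i k" if "i \<in> {1..n}" for i
    using strict_mono_onD[OF assms(2)[OF that] jk] .
  have "\<exists>i\<in>{1..n}. 0 < l i"
  proof (rule ccontr)
    assume "\<not> ?thesis"
    then have "(\<Sum>i=1..n. l i) \<le> 0"
      by (intro sum_nonpos) force
    with assms(1) show False
      by (simp add: convex_vector_def)
  qed
  then show "(\<Sum>i=1..n. l i * x i j) < (\<Sum>i=1..n. l i * x i k)"
    using less assms(1) by (intro sum_strict_mono_ex1) (auto simp: convex_vector_def less_imp_le mult_left_mono intro!: mult_strict_left_mono bexI)
qed

text \<open>Duality bounds the objective of every competitor below by the weighted sum of the
  \<open>\<psi> i\<close>; matching atoms by index bounds the objective of the candidate above by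
  the same number.\<close>

lemma wasserstein_barycenter_sorted:
  assumes N: "N \<ge> 1" and l: "convex_vector n l"
    and x: "\<And>i. i \<in> {1..n} \<Longrightarrow> strict_mono_on {1..N} (x i)"
    and \<mu>: "\<And>i. i \<in> {1..n} \<Longrightarrow> \<mu> i = empirical N (x i)"
  shows "wasserstein_barycenter n l \<mu> (empirical N (\<lambda>j. \<Sum>i=1..n. l i * x i j))"
proof -
  define z where "z j = (\<Sum>i=1..n. l i * x i j)" for j
  have z: "strict_mono_on {1..N} z"
    using convex_combination_strict_mono[OF l x] by (simp add: z_def[abs_def])
  have l0: "\<And>i. i \<in> {1..n} \<Longrightarrow> 0 \<le> l i" and l1: "(\<Sum>i=1..n. l i) = 1"
    using l by (auto simp: convex_vector_def)
  \<comment> \<open>The constants \<open>x i 1 * z 1 / 2\<close> average to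
    \<open>(z 1)\<^sup>2 / 2\<close>, the constant demanded by
    \<open>dual_weight_self\<close>.\<close>
  define w where "w i = dual_weight (x i 1 * z 1 / 2) z (x i)" for i
  define u where "u i t = Max ((\<lambda>k. x i k * t - w i k) ` {1..N})" for i t
  define \<psi> where "\<psi> i = (\<Sum>k=1..N. (x i k)\<^sup>2 - 2 * w i k) / real N" for i
  have sum_w: "(\<Sum>i=1..n. l i * w i k) = (z k)\<^sup>2 / 2" if "1 \<le> k" for k
  proof -
    have "(\<Sum>i=1..n. l i * (x i 1 * z 1 / 2)) = (z 1)\<^sup>2 / 2"
      by (simp add: z_def power2_eq_square sum_distrib_right sum_divide_distrib mult.assoc)
    moreover have "(\<lambda>j. \<Sum>i=1..n. l i * x i j) = z"
      by (simp add: z_def fun_eq_iff)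
    ultimately show ?thesis
      unfolding w_def sum_dual_weight by (simp only: dual_weight_self[OF that])
  qed
  have le_u: "x i k * t - w i k \<le> u i t" if "k \<in> {1..N}" for i k t
    unfolding u_def using that by (intro Max_ge) auto
  have u_meas [measurable]: "u i \<in> borel_measurable borel" for i
    unfolding u_def[abs_def] by (intro borel_measurable_Max) auto
  have sum_u: "(\<Sum>i=1..n. l i * u i t) \<le> t\<^sup>2 / 2" for t
  proof -
    \<comment> \<open>The nearest atom of \<open>z\<close> gives an index that is maximal in all
      \<open>u i\<close> at once, so the weighted sum is bounded by the tangent of
      \<open>t^2 / 2\<close> at \<open>z J\<close>.\<close>
    obtain J where J: "J \<in> {1..N}" "\<And>k. k \<in> {1..N} \<Longrightarrow> \<bar>t - z J\<bar> \<le> \<bar>t - z k\<bar>"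
      using ex_min_if_finite[of "(\<lambda>k. \<bar>t - z k\<bar>) ` {1..N}"] N by (fastforce simp: not_less)
    have "u i t \<le> x i J * t - w i J" if "i \<in> {1..n}" for i
      unfolding u_def w_def using N nearest_atom_maximizes[OF z x[OF that] J(1) _ J(2)]
      by (subst Max_le_iff) auto
    then have "(\<Sum>i=1..n. l i * u i t) \<le> (\<Sum>i=1..n. l i * (x i J * t - w i J))"
      using l0 by (intro sum_mono mult_left_mono) auto
    also have "\<dots> = (\<Sum>i=1..n. l i * x i J) * t - (\<Sum>i=1..n. l i * w i J)"
      by (simp add: sum_subtractf sum_distrib_left sum_distrib_right algebra_simps)
    also have "\<dots> = z J * t - (z J)\<^sup>2 / 2"
      using J(1) by (simp add: sum_w z_def)
    also have "\<dots> \<le> t\<^sup>2 / 2"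
      using zero_le_power2[of "t - z J"] by (simp add: power2_diff algebra_simps)
    finally show ?thesis .
  qed
  have lower: "(\<Sum>i=1..n. l i * \<psi> i) \<le> (\<Sum>i=1..n. l i * (W2 \<nu> (\<mu> i))\<^sup>2)" if \<nu>: "\<nu> \<in> P2" for \<nu>
  proof -
    interpret \<nu>: prob_space \<nu>
      using \<nu> by (simp add: P2_def)
    have [measurable_cong]: "sets \<nu> = sets borel" and sq: "integrable \<nu> (\<lambda>t. t\<^sup>2)"
      using \<nu> by (auto simp: P2_def)
    have id: "integrable \<nu> (\<lambda>t. t)"
      by (rule \<nu>.square_integrable_imp_integrable[OF _ sq]) simp
    have int_u: "integrable \<nu> (u i)" for i
    proof (rule Bochner_Integration.integrable_bound)
      show "integrable \<nu> (\<lambda>t. \<Sum>k=1..N. \<bar>x i k * t - w i k\<bar>)"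
        using id by simp
      show "AE t in \<nu>. norm (u i t) \<le> norm (\<Sum>k=1..N. \<bar>x i k * t - w i k\<bar>)"
      proof (rule AE_I2)
        fix t
        have "u i t \<in> (\<lambda>k. x i k * t - w i k) ` {1..N}"
          unfolding u_def using N by (intro Max_in) auto
        then obtain k where "k \<in> {1..N}" "u i t = x i k * t - w i k" by blast
        then show "norm (u i t) \<le> norm (\<Sum>k=1..N. \<bar>x i k * t - w i k\<bar>)"
          using member_le_sum[of k "{1..N}" "\<lambda>k. \<bar>x i k * t - w i k\<bar>"] by simp
      qed
    qed simp
    have "0 \<le> (\<integral>t. (\<Sum>i=1..n. l i * (t\<^sup>2 - 2 * u i t)) \<partial>\<nu>)"
    proof (rule integral_nonneg_AE, rule AE_I2)
      fix t
      have "(\<Sum>i=1..n. l i * (t\<^sup>2 - 2 * u i t)) = (\<Sum>i=1..n. l i) * t\<^sup>2 - 2 * (\<Sum>i=1..n. l i * u i t)"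
        by (simp add: sum_subtractf sum_distrib_left sum_distrib_right algebra_simps)
      then show "0 \<le> (\<Sum>i=1..n. l i * (t\<^sup>2 - 2 * u i t))"
        using sum_u[of t] l1 by simp
    qed
    also have "\<dots> = (\<Sum>i=1..n. l i * (\<integral>t. t\<^sup>2 - 2 * u i t \<partial>\<nu>))"
      using sq int_u by (subst Bochner_Integration.integral_sum) simp_all
    finally have "(\<Sum>i=1..n. l i * \<psi> i) \<le> (\<Sum>i=1..n. l i * ((\<integral>t. t\<^sup>2 - 2 * u i t \<partial>\<nu>) + \<psi> i))"
      by (simp add: distrib_left sum.distrib)
    also have "\<dots> \<le> (\<Sum>i=1..n. l i * (W2 \<nu> (\<mu> i))\<^sup>2)"
    proof (intro sum_mono mult_left_mono)
      fix i assume i: "i \<in> {1..n}"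
      show "(\<integral>t. t\<^sup>2 - 2 * u i t \<partial>\<nu>) + \<psi> i \<le> (W2 \<nu> (\<mu> i))\<^sup>2"
        unfolding \<mu>[OF i] \<psi>_def
        by (rule W2_empirical_ge[OF N \<nu> strict_mono_on_imp_inj_on[OF x[OF i]] u_meas int_u le_u])
    qed (use l0 in auto)
    finally show ?thesis .
  qed
  have "(\<Sum>i=1..n. l i * (W2 (empirical N z) (\<mu> i))\<^sup>2) \<le> (\<Sum>i=1..n. l i * ((\<Sum>k=1..N. (z k - x i k)\<^sup>2) / real N))"
    using l0 \<mu> W2_empirical_le[OF N] by (intro sum_mono mult_left_mono) auto
  also have "\<dots> = (\<Sum>k=1..N. \<Sum>i=1..n. l i * (z k - x i k)\<^sup>2) / real N"
    by (subst sum.swap) (simp add: sum_distrib_left sum_divide_distrib)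
  \<comment> \<open>Since the \<open>x i k\<close> average to \<open>z k\<close>, expanding the
    square leaves \<open>- (z k)\<^sup>2\<close>, which by \<open>sum_w\<close> is minus twice the
    average of the \<open>w i k\<close>.\<close>
  also have "(\<Sum>k=1..N. \<Sum>i=1..n. l i * (z k - x i k)\<^sup>2) = (\<Sum>k=1..N. \<Sum>i=1..n. l i * ((x i k)\<^sup>2 - 2 * w i k))"
  proof (rule sum.cong[OF refl])
    fix k assume k: "k \<in> {1..N}"
    have "(\<Sum>i=1..n. l i * (z k - x i k)\<^sup>2)
        = (\<Sum>i=1..n. l i) * (z k)\<^sup>2 - 2 * (\<Sum>i=1..n. l i * x i k) * z k + (\<Sum>i=1..n. l i * (x i k)\<^sup>2)"
      by (simp add: power2_diff sum_distrib_left sum_distrib_right sum.distrib sum_subtractf algebra_simps)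
    also have "\<dots> = (\<Sum>i=1..n. l i * (x i k)\<^sup>2) - 2 * (\<Sum>i=1..n. l i * w i k)"
      using k by (simp add: l1 sum_w z_def[symmetric] power2_eq_square)
    also have "\<dots> = (\<Sum>i=1..n. l i * ((x i k)\<^sup>2 - 2 * w i k))"
      by (simp add: sum_distrib_left sum_subtractf algebra_simps)
    finally show "(\<Sum>i=1..n. l i * (z k - x i k)\<^sup>2) = (\<Sum>i=1..n. l i * ((x i k)\<^sup>2 - 2 * w i k))" .
  qed
  also have "\<dots> / real N = (\<Sum>i=1..n. l i * \<psi> i)"
    unfolding \<psi>_def by (subst sum.swap) (simp add: sum_distrib_left sum_divide_distrib)
  finally have upper: "(\<Sum>i=1..n. l i * (W2 (empirical N z) (\<mu> i))\<^sup>2) \<le> (\<Sum>i=1..n. l i * \<psi> i)" .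
  have "is_arg_min (\<lambda>\<nu>. \<Sum>i=1..n. l i * (W2 \<nu> (\<mu> i))\<^sup>2) (\<lambda>\<nu>. \<nu> \<in> P2) (empirical N z)"
    unfolding is_arg_min_linorder using upper lower empirical_in_P2[OF N] by (blast intro: order_trans)
  then show ?thesis
    by (simp add: wasserstein_barycenter_def z_def[abs_def])
qed

text \<open>The symmetric limit has weights \<open>1 / n\<close>, the standard barycenter weights 1;
  a positive factor leaves the minimizers unchanged.\<close>

lemma wasserstein_barycenter_uniform:
  assumes "n \<ge> 1" and "wasserstein_barycenter n (\<lambda>_. 1 / real n) \<mu> \<nu>"
  shows "wasserstein_barycenter n (\<lambda>_. 1) \<mu> \<nu>"
  using assms unfolding wasserstein_barycenter_def is_arg_min_linorder
  by (simp add: sum_divide_distrib[symmetric] divide_le_cancel)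

section \<open>The algorithms as gossip schemes\<close>

context gossip_network
begin

text \<open>An agent's positive share of its own value keeps the inequality strict; the partner's
  share may be 0 and contributes a weak one. Thus \<open>displacement_sorted\<close> stays
  applicable at every time.\<close>

lemma gossip_strict_mono_on:
  assumes "\<And>t. e t \<in> E" and "\<And>v. v \<in> V \<Longrightarrow> strict_mono_on I (x v)" and "v \<in> V"
  shows "strict_mono_on I (\<lambda>j. gossip b h (\<lambda>u. x u j) e t v)"
proof (rule strict_mono_onI)
  fix j k assume jk: "j \<in> I" "k \<in> I" "j < k"
  show "gossip b h (\<lambda>u. x u j) e t v < gossip b h (\<lambda>u. x u k) e t v"
    using \<open>v \<in> V\<close>
  proof (induction t arbitrary: v)
    case 0
    then show ?case
      using strict_mono_onD[OF assms(2) jk] by simp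
  next
    case (Suc t)
    have "(1 - b (e t) v) * gossip b h (\<lambda>u. x u j) e t v < (1 - b (e t) v) * gossip b h (\<lambda>u. x u k) e t v"
      using Suc weight_less_1[OF assms(1)] by (intro mult_strict_left_mono) auto
    moreover have "b (e t) v * gossip b h (\<lambda>u. x u j) e t (h (e t) v) \<le> b (e t) v * gossip b h (\<lambda>u. x u k) e t (h (e t) v)"
      using Suc weight_nonneg[OF assms(1)] partner_in_V[OF assms(1)] by (intro mult_left_mono) (auto intro: less_imp_le)
    ultimately show ?case
      by (simp add: gossip_step_def)
  qed
qed

lemma gossip_expansion:
  assumes "\<And>t. e t \<in> E" and "v \<in> V"
  shows "gossip b h y0 e t v = (\<Sum>m\<in>V. y0 m * gossip b h (indicator {m}) e t v)"
  by (rule gossip_linear_comb[OF finite_V]) (use assms partner_in_V in auto)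

text \<open>Steps preserve nonnegativity and fix constants, so each row of the matrix product is a
  convex vector; both properties pass to the limit.\<close>

lemma limit_weights_convex:
  assumes e: "\<And>t. e t \<in> E"
    and lim: "\<And>m v. m \<in> V \<Longrightarrow> v \<in> V \<Longrightarrow> (\<lambda>t. gossip b h (indicator {m}) e t v) \<longlonglongrightarrow> l m"
  shows "m \<in> V \<Longrightarrow> 0 \<le> l m" and "(\<Sum>m\<in>V. l m) = 1"
proof -
  obtain v where v: "v \<in> V"
    using V_nonempty by auto
  show "0 \<le> l m" if "m \<in> V"
    by (rule LIMSEQ_le_const[OF lim[OF that v]]) (auto intro!: gossip_nonneg e v)
  have "(\<Sum>m\<in>V. gossip b h (indicator {m}) e t v) = 1" for t
    using gossip_expansion[OF e v, where ?y0.0 = "\<lambda>_. 1" and t = t] by (simp add: gossip_const)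
  moreover have "(\<lambda>t. \<Sum>m\<in>V. gossip b h (indicator {m}) e t v) \<longlonglongrightarrow> (\<Sum>m\<in>V. l m)"
    by (intro tendsto_sum lim v)
  ultimately show "(\<Sum>m\<in>V. l m) = 1"
    by (simp add: LIMSEQ_const_iff)
qed

lemma gossip_tendsto:
  assumes e: "\<And>t. e t \<in> E"
    and lim: "\<And>m v. m \<in> V \<Longrightarrow> v \<in> V \<Longrightarrow> (\<lambda>t. gossip b h (indicator {m}) e t v) \<longlonglongrightarrow> l m"
    and v: "v \<in> V"
  shows "(\<lambda>t. gossip b h y0 e t v) \<longlonglongrightarrow> (\<Sum>m\<in>V. l m * y0 m)"
proof -
  have "(\<lambda>t. \<Sum>m\<in>V. y0 m * gossip b h (indicator {m}) e t v) \<longlonglongrightarrow> (\<Sum>m\<in>V. y0 m * l m)"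
    by (intro tendsto_sum tendsto_mult_left lim v)
  then show ?thesis
    by (simp add: gossip_expansion[OF e v, where ?y0.0 = y0] mult.commute)
qed

end

lemma W2_empirical_tendsto_0:
  assumes N: "N \<ge> 1" and "\<And>j. j \<in> {1..N} \<Longrightarrow> (\<lambda>t. x t j) \<longlonglongrightarrow> z j"
  shows "(\<lambda>t. W2 (empirical N (x t)) (empirical N z)) \<longlonglongrightarrow> 0"
proof -
  have "(\<lambda>t. (\<Sum>j=1..N. (x t j - z j)\<^sup>2) / real N) \<longlonglongrightarrow> (\<Sum>j=1..N. (z j - z j)\<^sup>2) / real N"
    using N assms(2) by (intro tendsto_intros) auto
  then have *: "(\<lambda>t. (\<Sum>j=1..N. (x t j - z j)\<^sup>2) / real N) \<longlonglongrightarrow> 0"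
    by simp
  have "(\<lambda>t. (W2 (empirical N (x t)) (empirical N z))\<^sup>2) \<longlonglongrightarrow> 0"
    by (rule real_tendsto_sandwich[OF _ _ tendsto_const *]) (simp_all add: W2_empirical_le[OF N])
  then show ?thesis
    by simp
qed

text \<open>Common end of both cases: since \<open>l\<close> does not depend on the atom index
  \<open>j\<close>, the limit atoms are exactly the averages that make up a barycenter.\<close>

lemma consensus_barycenter:
  assumes net: "gossip_network {1..n} E b h" and N: "N \<ge> 1" and e: "\<And>t. e t \<in> E"
    and x: "\<And>i. i \<in> {1..n} \<Longrightarrow> strict_mono_on {1..N} (x i)"
    and \<mu>0: "\<And>i. i \<in> {1..n} \<Longrightarrow> \<mu>0 i = empirical N (x i)"
    and lim: "\<And>m v. m \<in> {1..n} \<Longrightarrow> v \<in> {1..n} \<Longrightarrow> (\<lambda>t. gossip b h (indicator {m}) e t v) \<longlonglongrightarrow> l m"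
    and M: "\<And>t i. i \<in> {1..n} \<Longrightarrow> M t i = empirical N (\<lambda>j. gossip b h (\<lambda>u. x u j) e t i)"
  shows "\<exists>\<mu>inf. (\<forall>i\<in>{1..n}. (\<lambda>t. W2 (M t i) \<mu>inf) \<longlonglongrightarrow> 0) \<and> wasserstein_barycenter n l \<mu>0 \<mu>inf"
proof (intro exI conjI ballI)
  interpret gossip_network "{1..n}" E b h
    by (rule net)
  have "convex_vector n l"
    using limit_weights_convex[OF e lim] by (simp add: convex_vector_def)
  with x \<mu>0 show "wasserstein_barycenter n l \<mu>0 (empirical N (\<lambda>j. \<Sum>i=1..n. l i * x i j))"
    by (intro wasserstein_barycenter_sorted[OF N]) auto
  show "(\<lambda>t. W2 (M t i) (empirical N (\<lambda>j. \<Sum>i=1..n. l i * x i j))) \<longlonglongrightarrow> 0" if "i \<in> {1..n}" for i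
    unfolding M[OF that] using gossip_tendsto[OF e lim that]
    by (intro W2_empirical_tendsto_0[OF N]) simp
qed

section \<open>Edge updates on directed and undirected graphs\<close>

definition directed_weight :: "(nat \<times> nat \<Rightarrow> real) \<Rightarrow> nat \<times> nat \<Rightarrow> nat \<Rightarrow> real" where
  "directed_weight a e k = (if k = fst e then a e else 0)"

text \<open>Total in \<open>k\<close>: a bystander has weight 0, so its partner need only be some
  vertex. In \<open>symmetric_partner\<close> a bystander is likewise given
  \<open>Min e\<close>.\<close>

definition directed_partner :: "nat \<times> nat \<Rightarrow> nat \<Rightarrow> nat" where
  "directed_partner e k = snd e"

definition symmetric_weight :: "nat set \<Rightarrow> nat \<Rightarrow> real" where
  "symmetric_weight e k = (if k \<in> e then 1 / 2 else 0)"

definition symmetric_partner :: "nat set \<Rightarrow> nat \<Rightarrow> nat" where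
  "symmetric_partner e k = (if k = Min e then Max e else Min e)"

text \<open>A path from outside \<open>S\<close> into \<open>S\<close> has to cross. In an arc
  \<open>(u, v)\<close> it is \<open>u\<close> that moves towards \<open>v\<close>, so influence
  leaves \<open>S\<close> along such an arc.\<close>

lemma strongly_connected_crossing_arc:
  assumes sc: "strongly_connected (with_proj G)" and S: "S \<subseteq> pverts G" "S \<noteq> {}" "S \<noteq> pverts G"
  shows "\<exists>(u, v)\<in>parcs G. u \<notin> S \<and> v \<in> S"
proof -
  obtain r s where rs: "r \<in> pverts G" "r \<notin> S" "s \<in> S"
    using S by auto
  then have "(r, s) \<in> rtrancl_on (pverts G) (parcs G)"
    using sc S unfolding strongly_connected_def reachable_def by auto
  from this rs(2,3) show ?thesis
    by (induction rule: rtrancl_on.induct) auto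
qed

context
  fixes G :: "nat pair_pre_digraph" and a :: "nat \<times> nat \<Rightarrow> real"
  assumes G: "pair_fin_digraph G" and sc: "strongly_connected (with_proj G)"
    and a: "\<forall>e\<in>parcs G. a e \<in> {0<..<1}"
begin

interpretation pair_fin_digraph G
  by (rule G)

lemma directed_gossip_network:
  "gossip_network (pverts G) (parcs G) (directed_weight a) directed_partner"
proof
  show "finite (pverts G)"
    by (rule pair_finite_verts)
  show "pverts G \<noteq> {}"
    using sc by (simp add: strongly_connected_def)
  show "\<exists>e\<in>parcs G. \<exists>v\<in>pverts G - S. 0 < directed_weight a e v \<and> directed_partner e v \<in> S"
    if S: "S \<subseteq> pverts G" "S \<noteq> {}" "S \<noteq> pverts G" for S
  proof -
    obtain u v where "(u, v) \<in> parcs G" "u \<notin> S" "v \<in> S"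
      using strongly_connected_crossing_arc[OF sc S] by auto
    then show ?thesis
      using a by (intro bexI[of _ "(u, v)"] bexI[of _ u])
        (auto simp: directed_weight_def directed_partner_def dest: in_arcsD1)
  qed
qed (use a in \<open>auto simp: directed_weight_def directed_partner_def less_imp_le dest: in_arcsD2\<close>)

interpretation gossip_network "pverts G" "parcs G" "directed_weight a" directed_partner
  by (rule directed_gossip_network)

lemma directed_pawbar_eq_empirical:
  assumes N: "N \<ge> 1" and x: "\<And>i. i \<in> pverts G \<Longrightarrow> strict_mono_on {1..N} (x i)"
    and \<mu>0: "\<And>i. i \<in> pverts G \<Longrightarrow> \<mu>0 i = empirical N (x i)"
    and e: "\<And>t. e t \<in> parcs G" and "i \<in> pverts G"
  shows "directed_pawbar a \<mu>0 e t i =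
    empirical N (\<lambda>j. gossip (directed_weight a) directed_partner (\<lambda>u. x u j) e t i)"
  using \<open>i \<in> pverts G\<close>
proof (induction t arbitrary: i)
  case 0
  then show ?case
    by (simp add: \<mu>0)
next
  case (Suc t)
  obtain u v where uv: "e t = (u, v)"
    by fastforce
  then have "u \<in> pverts G" "v \<in> pverts G"
    using e[of t] in_arcsD1 in_arcsD2 by auto
  then have "displacement (a (u, v)) (directed_pawbar a \<mu>0 e t u) (directed_pawbar a \<mu>0 e t v)
    = empirical N (\<lambda>j. (1 - a (u, v)) * gossip (directed_weight a) directed_partner (\<lambda>u. x u j) e t u
        + a (u, v) * gossip (directed_weight a) directed_partner (\<lambda>u. x u j) e t v)"
    using gossip_strict_mono_on[OF e x] by (simp add: Suc.IH displacement_sorted[OF N])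
  moreover have "directed_weight a (u, v) i = (if i = u then a (u, v) else 0)" "directed_partner (u, v) i = v"
    by (simp_all add: directed_weight_def directed_partner_def)
  ultimately show ?case
    using Suc by (simp add: uv gossip_step_def)
qed

end

context
  fixes G :: "nat pair_pre_digraph"
  assumes G: "pair_graph G" and con: "Digraph_Component.connected (with_proj G)"
begin

interpretation pair_graph G
  by (rule G)

lemma undirected_edgesE:
  assumes "e \<in> undirected_edges G"
  obtains u v where "u \<in> pverts G" "v \<in> pverts G" "u < v" "e = {u, v}" "Min e = u" "Max e = v"
proof -
  from assms obtain i j where ij: "e = {i, j}" "(i, j) \<in> parcs G"
    by (auto simp: undirected_edges_def)
  then have "i \<noteq> j" "i \<in> pverts G" "j \<in> pverts G"
    using pair_no_loops[of "(i, j)"] in_arcsD1 in_arcsD2 by auto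
  then show thesis
    using that[of i j] that[of j i] ij(1) by (cases "i < j") (auto simp: insert_commute)
qed

lemma symmetric_gossip_network:
  "gossip_network (pverts G) (undirected_edges G) symmetric_weight symmetric_partner"
proof
  have sc: "strongly_connected (with_proj G)"
    by (rule symmetric_connected_imp_strongly_connected[OF pair_sym_arcs con])
  show "finite (pverts G)"
    by (rule pair_finite_verts)
  show "pverts G \<noteq> {}"
    using sc by (simp add: strongly_connected_def)
  show "symmetric_partner e v \<in> pverts G" if "e \<in> undirected_edges G" for e v
    using that by (elim undirected_edgesE) (simp add: symmetric_partner_def)
  show "\<exists>e\<in>undirected_edges G. \<exists>v\<in>pverts G - S. 0 < symmetric_weight e v \<and> symmetric_partner e v \<in> S"
    if S: "S \<subseteq> pverts G" "S \<noteq> {}" "S \<noteq> pverts G" for S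
  proof -
    obtain u v where uv: "(u, v) \<in> parcs G" "u \<notin> S" "v \<in> S"
      using strongly_connected_crossing_arc[OF sc S] by auto
    then have "symmetric_partner {u, v} u = v"
      by (auto simp: symmetric_partner_def min_def max_def)
    with uv show ?thesis
      by (intro bexI[of _ "{u, v}"] bexI[of _ u])
        (auto simp: symmetric_weight_def undirected_edges_def dest: in_arcsD1)
  qed
qed (auto simp: symmetric_weight_def)

interpretation gossip_network "pverts G" "undirected_edges G" symmetric_weight symmetric_partner
  by (rule symmetric_gossip_network)

text \<open>Both endpoints move to their midpoint, so the two changes cancel; the step matrices are
  doubly stochastic, which pins down the limit weights.\<close>

lemma sum_symmetric_gossip:
  assumes e: "\<And>t. e t \<in> undirected_edges G"
  shows "(\<Sum>v\<in>pverts G. gossip symmetric_weight symmetric_partner y0 e t v) = (\<Sum>v\<in>pverts G. y0 v)"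
proof (induction t)
  case (Suc t)
  let ?y = "gossip symmetric_weight symmetric_partner y0 e t"
  let ?d = "\<lambda>v. gossip_step symmetric_weight symmetric_partner (e t) ?y v - ?y v"
  have "(\<Sum>v\<in>pverts G. ?d v) = 0"
  proof -
    obtain u v where uv: "u \<in> pverts G" "v \<in> pverts G" "u < v" "e t = {u, v}" "Min (e t) = u" "Max (e t) = v"
      using undirected_edgesE[OF e[of t]] .
    have "(\<Sum>i\<in>pverts G. ?d i) = (\<Sum>i\<in>{u, v}. ?d i)"
      using uv(1,2,4) by (intro sum.mono_neutral_right finite_V)
        (auto simp: gossip_step_def symmetric_weight_def)
    also have "\<dots> = 0"
      unfolding gossip_step_def symmetric_weight_def symmetric_partner_def uv(5,6)
      using uv(3,4) by simp
    finally show ?thesis .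
  qed
  then show ?case
    using Suc by (simp add: sum_subtractf)
qed simp

lemma symmetric_pawbar_eq_empirical:
  assumes N: "N \<ge> 1" and x: "\<And>i. i \<in> pverts G \<Longrightarrow> strict_mono_on {1..N} (x i)"
    and \<mu>0: "\<And>i. i \<in> pverts G \<Longrightarrow> \<mu>0 i = empirical N (x i)"
    and e: "\<And>t. e t \<in> undirected_edges G" and "i \<in> pverts G"
  shows "symmetric_pawbar \<mu>0 e t i =
    empirical N (\<lambda>j. gossip symmetric_weight symmetric_partner (\<lambda>u. x u j) e t i)"
  using \<open>i \<in> pverts G\<close>
proof (induction t arbitrary: i)
  case 0
  then show ?case
    by (simp add: \<mu>0)
next
  case (Suc t)
  obtain u v where uv: "u \<in> pverts G" "v \<in> pverts G" "u < v" "e t = {u, v}" "Min (e t) = u" "Max (e t) = v"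
    using undirected_edgesE[OF e[of t]] .
  have disp: "displacement (1 / 2) (symmetric_pawbar \<mu>0 e t u) (symmetric_pawbar \<mu>0 e t v)
    = empirical N (\<lambda>j. (1 - 1 / 2) * gossip symmetric_weight symmetric_partner (\<lambda>u. x u j) e t u
        + (1 / 2) * gossip symmetric_weight symmetric_partner (\<lambda>u. x u j) e t v)"
    using gossip_strict_mono_on[OF e x] uv by (simp only: Suc.IH displacement_sorted[OF N])
  have step: "symmetric_pawbar \<mu>0 e (Suc t) i =
     (if i \<in> {u, v} then displacement (1 / 2) (symmetric_pawbar \<mu>0 e t u) (symmetric_pawbar \<mu>0 e t v)
      else symmetric_pawbar \<mu>0 e t i)"
    by (simp only: symmetric_pawbar.simps Let_def uv(5,6)) auto
  have "symmetric_weight (e t) i = (if i \<in> {u, v} then 1 / 2 else 0)"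
    "symmetric_partner (e t) i = (if i = u then v else u)"
    unfolding symmetric_weight_def symmetric_partner_def uv(5,6) using uv(4) by simp_all
  \<comment> \<open>Each endpoint lists its own half first in \<open>gossip_step\<close>; with
    weight 1/2 the order does not matter and both get the same atoms.\<close>
  then show ?case
    unfolding step disp using Suc uv(3)
    by (auto simp: gossip_step_def algebra_simps)
qed

end

section \<open>Almost sure convergence to a barycenter\<close>

lemma AE_directed_pawbar:
  fixes G :: "nat pair_pre_digraph" and p :: "(nat \<times> nat) pmf"
  assumes N: "N \<ge> 1" and G: "pair_fin_digraph G" "strongly_connected (with_proj G)"
    and a: "\<forall>e\<in>parcs G. a e \<in> {0<..<1}"
    and V: "pverts G = {1..n}" and p: "set_pmf p = parcs G"
    and x: "\<And>i. i \<in> {1..n} \<Longrightarrow> strict_mono_on {1..N} (x i)"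
    and \<mu>0: "\<And>i. i \<in> {1..n} \<Longrightarrow> \<mu>0 i = empirical N (x i)"
  shows "\<exists>l. random_convex_vector (edge_process p) n l \<and>
          (AE e in edge_process p. \<exists>\<mu>inf.
             (\<forall>i\<in>{1..n}. (\<lambda>t. W2 (directed_pawbar a \<mu>0 e t i) \<mu>inf) \<longlonglongrightarrow> 0) \<and>
             wasserstein_barycenter n (l e) \<mu>0 \<mu>inf)"
proof -
  let ?g = "gossip (directed_weight a) directed_partner"
  let ?M = "edge_process p"
  interpret gossip_network "pverts G" "parcs G" "directed_weight a" directed_partner
    by (rule directed_gossip_network[OF G a])
  have n: "1 \<in> {1..n}"
    using V_nonempty V by auto
  define good where "good e \<longleftrightarrow> (\<forall>t. e t \<in> parcs G) \<and>
    (\<forall>m\<in>pverts G. \<exists>c. \<forall>v\<in>pverts G. (\<lambda>t. ?g (indicator {m}) e t v) \<longlonglongrightarrow> c)" for e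
  have "AE e in ?M. good e"
    using AE_edge_process_in_support[of p] AE_consensus[OF p] p unfolding good_def by auto
  \<comment> \<open>Instead of showing \<open>good\<close> measurable, a measurable null set
    covering its failures is taken, so that \<open>l\<close> is measurable.\<close>
  then obtain Z where Z: "{e \<in> space ?M. \<not> good e} \<subseteq> Z" "emeasure ?M Z = 0" "Z \<in> sets ?M"
    by (rule AE_E)
  \<comment> \<open>Convexity is demanded at every outcome, hence the uniform default on
    \<open>Z\<close>. Elsewhere all agents share the limit, and it is read off at agent 1.\<close>
  define l where "l e m = (if e \<in> Z then 1 / real n else lim (\<lambda>t. ?g (indicator {m}) e t 1))" for e m
  have lim: "(\<lambda>t. ?g (indicator {m}) e t v) \<longlonglongrightarrow> l e m"
    if e: "good e" "e \<notin> Z" and m: "m \<in> pverts G" and v: "v \<in> pverts G" for e m v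
  proof -
    obtain c where c: "\<forall>v\<in>pverts G. (\<lambda>t. ?g (indicator {m}) e t v) \<longlonglongrightarrow> c"
      using e m by (auto simp: good_def)
    with n V have "lim (\<lambda>t. ?g (indicator {m}) e t 1) = c"
      by (intro limI) auto
    with c v e show ?thesis
      by (simp add: l_def)
  qed
  have "random_convex_vector ?M n l"
    unfolding random_convex_vector_def
  proof (intro conjI ballI)
    fix m
    have "(\<lambda>e. lim (\<lambda>t. ?g (indicator {m}) e t 1)) \<in> borel_measurable ?M"
      by (intro borel_measurable_lim_metric measurable_gossip)
    then show "(\<lambda>e. l e m) \<in> borel_measurable ?M"
      unfolding l_def using Z(3) by (intro measurable_If_set) auto
  next
    fix e assume "e \<in> space ?M"
    then have "good e" if "e \<notin> Z"
      using that Z(1) by auto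
    then show "convex_vector n (l e)"
      using limit_weights_convex[of e "l e"] lim n V
      by (cases "e \<in> Z") (auto simp: convex_vector_def l_def good_def)
  qed
  moreover have "AE e in ?M. \<exists>\<mu>inf.
       (\<forall>i\<in>{1..n}. (\<lambda>t. W2 (directed_pawbar a \<mu>0 e t i) \<mu>inf) \<longlonglongrightarrow> 0) \<and>
       wasserstein_barycenter n (l e) \<mu>0 \<mu>inf"
  proof -
    have "AE e in ?M. e \<notin> Z"
      using Z by (intro AE_not_in) auto
    with \<open>AE e in ?M. good e\<close> show ?thesis
    proof eventually_elim
      case (elim e)
      then have e: "\<And>t. e t \<in> parcs G"
        by (simp add: good_def)
      have M: "directed_pawbar a \<mu>0 e t i = empirical N (\<lambda>j. ?g (\<lambda>u. x u j) e t i)"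
        if "i \<in> pverts G" for t i
        using x \<mu>0 that by (intro directed_pawbar_eq_empirical[OF G a N]) (simp_all add: V e)
      show ?case
        by (rule consensus_barycenter[OF directed_gossip_network[OF G a, unfolded V] N e x \<mu>0
              lim[OF elim, unfolded V] M[unfolded V]])
    qed
  qed
  ultimately show ?thesis
    by blast
qed

lemma AE_symmetric_pawbar:
  fixes G :: "nat pair_pre_digraph" and q :: "nat set pmf"
  assumes N: "N \<ge> 1" and G: "pair_graph G" "Digraph_Component.connected (with_proj G)"
    and V: "pverts G = {1..n}" and q: "set_pmf q = undirected_edges G"
    and x: "\<And>i. i \<in> {1..n} \<Longrightarrow> strict_mono_on {1..N} (x i)"
    and \<mu>0: "\<And>i. i \<in> {1..n} \<Longrightarrow> \<mu>0 i = empirical N (x i)"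
  shows "AE e in edge_process q. \<exists>\<mu>inf.
           (\<forall>i\<in>{1..n}. (\<lambda>t. W2 (symmetric_pawbar \<mu>0 e t i) \<mu>inf) \<longlonglongrightarrow> 0) \<and>
           wasserstein_barycenter n (\<lambda>_. 1) \<mu>0 \<mu>inf"
proof -
  let ?g = "gossip symmetric_weight symmetric_partner"
  interpret gossip_network "pverts G" "undirected_edges G" symmetric_weight symmetric_partner
    by (rule symmetric_gossip_network[OF G])
  have n: "n \<ge> 1"
    using V_nonempty V by auto
  show ?thesis
    using AE_edge_process_in_support[of q] AE_consensus[OF q]
  proof eventually_elim
    case (elim e)
    then have e: "\<And>t. e t \<in> undirected_edges G"
      by (simp add: q)
    have lim: "(\<lambda>t. ?g (indicator {m}) e t v) \<longlonglongrightarrow> 1 / real n"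
      if m: "m \<in> pverts G" and v: "v \<in> pverts G" for m v
    proof -
      obtain c where c: "\<And>v. v \<in> pverts G \<Longrightarrow> (\<lambda>t. ?g (indicator {m}) e t v) \<longlonglongrightarrow> c"
        using elim m by blast
      \<comment> \<open>The column sum stays 1 by conservation while its \<open>n\<close> entries
        all tend to \<open>c\<close>; hence \<open>n * c = 1\<close>.\<close>
      have "(\<lambda>t. \<Sum>v\<in>pverts G. ?g (indicator {m}) e t v) \<longlonglongrightarrow> (\<Sum>v\<in>pverts G. c)"
        by (intro tendsto_sum c)
      moreover have "(\<Sum>v\<in>pverts G. ?g (indicator {m}) e t v) = 1" for t
        using m finite_V by (subst sum_symmetric_gossip[OF G e]) (simp add: indicator_def)
      ultimately have "real n * c = 1"
        by (simp add: LIMSEQ_const_iff V)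
      then have "c = 1 / real n"
        using n by (simp add: field_simps)
      with c[OF v] show ?thesis
        by simp
    qed
    have M: "symmetric_pawbar \<mu>0 e t i = empirical N (\<lambda>j. ?g (\<lambda>u. x u j) e t i)"
      if "i \<in> pverts G" for t i
      using x \<mu>0 that by (intro symmetric_pawbar_eq_empirical[OF G N]) (simp_all add: V e)
    show ?case
      using consensus_barycenter[OF symmetric_gossip_network[OF G, unfolded V] N e x \<mu>0
          lim[unfolded V] M[unfolded V]] wasserstein_barycenter_uniform[OF n]
      by blast
  qed
qed

theorem corollary3p5:
  fixes n N :: nat
    and x :: "nat \<Rightarrow> nat \<Rightarrow> real"
    and \<mu>0 :: "nat \<Rightarrow> real measure"
  assumes "n \<ge> 2" and "N \<ge> 1"
    and "\<forall>i\<in>{1..n}. strict_mono_on {1..N} (x i)"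
    and "\<forall>i\<in>{1..n}. \<mu>0 i = empirical N (x i)"
  shows
    "(\<forall>(G :: nat pair_pre_digraph) (a :: nat \<times> nat \<Rightarrow> real) (p :: (nat \<times> nat) pmf).
        pair_fin_digraph G \<and> pverts G = {1..n} \<and> strongly_connected (with_proj G) \<and>
        (\<forall>e\<in>parcs G. a e \<in> {0<..<1}) \<and> set_pmf p = parcs G \<longrightarrow>
        (\<exists>l. random_convex_vector (edge_process p) n l \<and>
          (AE e in edge_process p. \<exists>\<mu>inf.
             (\<forall>i\<in>{1..n}. (\<lambda>t. W2 (directed_pawbar a \<mu>0 e t i) \<mu>inf) \<longlonglongrightarrow> 0) \<and>
             wasserstein_barycenter n (l e) \<mu>0 \<mu>inf)))
     \<and>
     (\<forall>(G :: nat pair_pre_digraph) (q :: nat set pmf).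
        pair_graph G \<and> pverts G = {1..n} \<and> Digraph_Component.connected (with_proj G) \<and>
        set_pmf q = undirected_edges G \<longrightarrow>
        (AE e in edge_process q. \<exists>\<mu>inf.
           (\<forall>i\<in>{1..n}. (\<lambda>t. W2 (symmetric_pawbar \<mu>0 e t i) \<mu>inf) \<longlonglongrightarrow> 0) \<and>
           wasserstein_barycenter n (\<lambda>_. 1) \<mu>0 \<mu>inf))"
proof (intro conjI allI impI)
  fix G :: "nat pair_pre_digraph" and a :: "nat \<times> nat \<Rightarrow> real" and p :: "(nat \<times> nat) pmf"
  assume "pair_fin_digraph G \<and> pverts G = {1..n} \<and> strongly_connected (with_proj G) \<and>
        (\<forall>e\<in>parcs G. a e \<in> {0<..<1}) \<and> set_pmf p = parcs G"
  with assms show "\<exists>l. random_convex_vector (edge_process p) n l \<and>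
          (AE e in edge_process p. \<exists>\<mu>inf.
             (\<forall>i\<in>{1..n}. (\<lambda>t. W2 (directed_pawbar a \<mu>0 e t i) \<mu>inf) \<longlonglongrightarrow> 0) \<and>
             wasserstein_barycenter n (l e) \<mu>0 \<mu>inf)"
    by (intro AE_directed_pawbar[where N = N and G = G and x = x]) auto
next
  fix G :: "nat pair_pre_digraph" and q :: "nat set pmf"
  assume "pair_graph G \<and> pverts G = {1..n} \<and> Digraph_Component.connected (with_proj G) \<and>
        set_pmf q = undirected_edges G"
  with assms show "AE e in edge_process q. \<exists>\<mu>inf.
           (\<forall>i\<in>{1..n}. (\<lambda>t. W2 (symmetric_pawbar \<mu>0 e t i) \<mu>inf) \<longlonglongrightarrow> 0) \<and>
           wasserstein_barycenter n (\<lambda>_. 1) \<mu>0 \<mu>inf"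
    by (intro AE_symmetric_pawbar[where N = N and G = G and x = x]) auto
qed

end
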